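(* Each caterpillar can be reconstructed from its $U$-polynomial.
   Context: A leaf of a tree is a vertex of degree one. A caterpillar is a tree in which all edges not incident with a leaf form a path. The $U$-polynomial of a graph $G=(V,E)$ is defined as follows. For $A\subseteq E$ let $c(A)$ be the number of connected components of the spanning subgraph $(V,A)$, let $n_1\ge\dots\ge n_{c(A)}$ be the numbers of vertices of these components, and let $x(A)=\prod_{i=1}^{c(A)}x_{n_i}$, where $x_1,x_2,\dots$ are indeterminates. Then $$U_G(z,x_1,x_2,\dots)=\sum_{A\subseteq E}x(A)(z-1)^{|A|-|V|+c(A)}.$$ (For a tree the exponent of $z-1$ is always $0$.) "Reconstructed" is meant in the constructive sense: the tree itself can be effectively recovered from the knowledge of its $U$-polynomial. This is regarded as a different and harder task than showing, possibly non-constructively, that non-isomorphic trees have different $U$-polynomials. *)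

theory Defs
  imports Main "HOL-Library.Poly_Mapping" "HOL-Library.Nat_Bijection"
begin

section \<open>Simple graphs, trees and caterpillars\<close>

definition simple_graph :: "'a set \<Rightarrow> 'a set set \<Rightarrow> bool" where
  "simple_graph V E \<longleftrightarrow> finite V \<and> E \<subseteq> {{u, v} | u v. u \<in> V \<and> v \<in> V \<and> u \<noteq> v}"

definition graph_iso :: "'a set \<Rightarrow> 'a set set \<Rightarrow> 'b set \<Rightarrow> 'b set set \<Rightarrow> bool" where
  "graph_iso V E V' E' \<longleftrightarrow>
     (\<exists>h. bij_betw h V V' \<and> (\<forall>u\<in>V. \<forall>v\<in>V. {u, v} \<in> E \<longleftrightarrow> {h u, h v} \<in> E'))"

definition reachable :: "'a set \<Rightarrow> 'a set set \<Rightarrow> ('a \<times> 'a) set" where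
  "reachable V A = {(u, v). u \<in> V \<and> v \<in> V \<and> (u, v) \<in> {(x, y). {x, y} \<in> A}\<^sup>*}"

definition components :: "'a set \<Rightarrow> 'a set set \<Rightarrow> 'a set set" where
  "components V A = V // reachable V A"

definition connected_graph :: "'a set \<Rightarrow> 'a set set \<Rightarrow> bool" where
  "connected_graph V E \<longleftrightarrow> V \<noteq> {} \<and> (\<forall>u\<in>V. \<forall>v\<in>V. (u, v) \<in> reachable V E)"

definition is_cycle :: "'a set set \<Rightarrow> 'a list \<Rightarrow> bool" where
  "is_cycle E vs \<longleftrightarrow> 3 \<le> length vs \<and> distinct vs \<and>
     (\<forall>i. Suc i < length vs \<longrightarrow> {vs ! i, vs ! Suc i} \<in> E) \<and> {last vs, hd vs} \<in> E"

definition tree :: "'a set \<Rightarrow> 'a set set \<Rightarrow> bool" where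
  "tree V E \<longleftrightarrow> simple_graph V E \<and> connected_graph V E \<and> (\<nexists>vs. is_cycle E vs)"

definition degree :: "'a set set \<Rightarrow> 'a \<Rightarrow> nat" where
  "degree E v = card {e \<in> E. v \<in> e}"

definition leaf :: "'a set \<Rightarrow> 'a set set \<Rightarrow> 'a \<Rightarrow> bool" where
  "leaf V E v \<longleftrightarrow> v \<in> V \<and> degree E v = 1"

text \<open>A path without edges is allowed, so that stars (in particular the trees with at most
  two vertices) are caterpillars.\<close>

definition path_edges :: "'a list \<Rightarrow> 'a set set" where
  "path_edges vs = {{vs ! i, vs ! Suc i} | i. Suc i < length vs}"

definition caterpillar :: "'a set \<Rightarrow> 'a set set \<Rightarrow> bool" where
  "caterpillar V E \<longleftrightarrow> tree V E \<and>
     (\<exists>vs. distinct vs \<and> set vs \<subseteq> V \<and> {e \<in> E. \<forall>v\<in>e. \<not> leaf V E v} = path_edges vs)"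


section \<open>The U-polynomial\<close>

text \<open>Integer polynomials in the variables with index 0, 1, 2 and so on: the variable with index
  0 plays the role of z, the one with index i > 0 that of the indeterminate \<open>x\<^sub>i\<close>.\<close>

type_synonym monom = "nat \<Rightarrow>\<^sub>0 nat"
type_synonym poly = "monom \<Rightarrow>\<^sub>0 int"

definition var :: "nat \<Rightarrow> poly" where
  "var i = Poly_Mapping.single (Poly_Mapping.single i 1) 1"

text \<open>The subtraction of natural numbers in the exponent never truncates, since
  \<open>card V \<le> card A + card (components V A)\<close> for every finite graph.\<close>

definition U_polynomial :: "'a set \<Rightarrow> 'a set set \<Rightarrow> poly" where
  "U_polynomial V E =
     (\<Sum>A\<in>Pow E. (\<Prod>C\<in>components V A. var (card C)) *
        (var 0 - 1) ^ (card A + card (components V A) - card V))"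


section \<open>Effective procedures\<close>

text \<open>The total recursive functions of one argument; several arguments are passed through the
  Cantor pairing function. Minimisation is restricted to the regular case.\<close>

inductive total_recursive :: "(nat \<Rightarrow> nat) \<Rightarrow> bool" where
  rec_zero: "total_recursive (\<lambda>_. 0)"
| rec_Suc: "total_recursive Suc"
| rec_fst: "total_recursive (\<lambda>n. fst (prod_decode n))"
| rec_snd: "total_recursive (\<lambda>n. snd (prod_decode n))"
| rec_pair: "total_recursive f \<Longrightarrow> total_recursive g \<Longrightarrow>
    total_recursive (\<lambda>n. prod_encode (f n, g n))"
| rec_comp: "total_recursive f \<Longrightarrow> total_recursive g \<Longrightarrow> total_recursive (\<lambda>n. f (g n))"
| rec_prim: "total_recursive f \<Longrightarrow> total_recursive g \<Longrightarrow>
    total_recursive (\<lambda>n. case prod_decode n of (a, k) \<Rightarrow>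
      rec_nat (f a) (\<lambda>i r. g (prod_encode (a, prod_encode (i, r)))) k)"
| rec_mu: "total_recursive f \<Longrightarrow> (\<forall>a. \<exists>k. f (prod_encode (a, k)) = 0) \<Longrightarrow>
    total_recursive (\<lambda>a. LEAST k. f (prod_encode (a, k)) = 0)"

text \<open>A polynomial is coded by the finite set of its terms: pairs of a monomial and its
  coefficient, a monomial in turn being the finite set of its pairs of a variable index and a
  positive exponent. By the lemmas below no two polynomials have the same code.\<close>

definition encode_monom :: "monom \<Rightarrow> nat" where
  "encode_monom m =
     set_encode ((\<lambda>i. prod_encode (i, Poly_Mapping.lookup m i)) ` Poly_Mapping.keys m)"

definition encode_poly :: "poly \<Rightarrow> nat" where
  "encode_poly p =
     set_encode ((\<lambda>m. prod_encode (encode_monom m, int_encode (Poly_Mapping.lookup p m)))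
       ` Poly_Mapping.keys p)"

lemma poly_mapping_eqI_graph:
  fixes p q :: "'a \<Rightarrow>\<^sub>0 'b::zero"
  assumes "(\<lambda>x. (x, Poly_Mapping.lookup p x)) ` Poly_Mapping.keys p =
    (\<lambda>x. (x, Poly_Mapping.lookup q x)) ` Poly_Mapping.keys q"
  shows "p = q"
proof (rule poly_mapping_eqI)
  fix x
  have "(x, y) \<in> (\<lambda>x. (x, Poly_Mapping.lookup r x)) ` Poly_Mapping.keys r \<longleftrightarrow>
      y = Poly_Mapping.lookup r x \<and> y \<noteq> 0" for y and r :: "'a \<Rightarrow>\<^sub>0 'b"
    by (auto simp: in_keys_iff)
  then show "Poly_Mapping.lookup p x = Poly_Mapping.lookup q x"
    using assms by metis
qed

lemma inj_encode_monom: "inj encode_monom"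
proof (rule injI)
  fix m m' assume "encode_monom m = encode_monom m'"
  then have "prod_encode ` (\<lambda>i. (i, Poly_Mapping.lookup m i)) ` Poly_Mapping.keys m =
      prod_encode ` (\<lambda>i. (i, Poly_Mapping.lookup m' i)) ` Poly_Mapping.keys m'"
    by (simp add: encode_monom_def set_encode_eq image_image)
  then show "m = m'"
    by (intro poly_mapping_eqI_graph) (simp add: inj_image_eq_iff inj_prod_encode)
qed

lemma inj_encode_poly: "inj encode_poly"
proof (rule injI)
  let ?c = "\<lambda>(m, a). prod_encode (encode_monom m, int_encode a)"
  have "inj ?c"
    by (auto intro!: injI dest: injD[OF inj_encode_monom] simp: int_encode_eq)
  fix p q assume "encode_poly p = encode_poly q"
  then have "?c ` (\<lambda>m. (m, Poly_Mapping.lookup p m)) ` Poly_Mapping.keys p =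
      ?c ` (\<lambda>m. (m, Poly_Mapping.lookup q m)) ` Poly_Mapping.keys q"
    by (simp add: encode_poly_def set_encode_eq image_image)
  then show "p = q"
    by (intro poly_mapping_eqI_graph) (simp add: inj_image_eq_iff[OF \<open>inj ?c\<close>])
qed

text \<open>The number coding the pair of n and k is read as the graph on \<open>{..<n}\<close> whose edges are
  the pairs belonging to the finite set coded by k. Every number codes a simple graph, and up to
  isomorphism every finite simple graph has a code.\<close>

definition decode_verts :: "nat \<Rightarrow> nat set" where
  "decode_verts c = {..<fst (prod_decode c)}"

definition decode_edges :: "nat \<Rightarrow> nat set set" where
  "decode_edges c = {{i, j} | i j. i \<in> decode_verts c \<and> j \<in> decode_verts c \<and> i \<noteq> j \<and>
     prod_encode (i, j) \<in> set_decode (snd (prod_decode c))}"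

end

theory Submission
  imports Defs Complex_Main "HOL-Library.Multiset"
begin

text \<open>A caterpillar is built from one vertex by steps that attach a new vertex to the current one:
  a spine step (\<open>True\<close>, the new vertex becomes the current one) or a leaf step
      (\<open>False\<close>). So it is
  given by a word, which can be taken to begin and end with a leaf step, and then the reversed word
  gives an isomorphic tree; a word is a lattice path from one corner of a rectangle to the other,
  and its reversal is that path rotated by a half turn.

  For a tree the U-polynomial is the multiset, over all edge sets A, of the multisets of component
  sizes. Two weighted sums over these are used. The first, over pairs of
  disjoint subtrees that together meet all edges, counts the turns of the path and of its reversal
  together (\<open>turn_weight\<close>). It determines, for every i, the unordered pair of the i-th spine
      steps of
  the path and of its reversal (\<open>step_weight\<close>), leaving open which of the two belongs to which
      path.
  The second sum, over single subtrees, then yields the multiset of the pieces lying strictly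
  between two spine steps, and the longest pieces that would change fix these choices up to a
  simultaneous exchange, that is, up to reversal of the word.

  The tree is therefore recovered by a search for a word with the given polynomial. The search is
  bounded, since the number of vertices is smaller than the code of the polynomial.\<close>

section \<open>Words as lattice paths\<close>

text \<open>Whatever the U-polynomial yields is symmetric in a path and its reversal. Sums that are
  linear in the two paths can therefore give no more than an unordered pair at each position; the
  convolution of the two paths is quadratic and ties the choices at different positions together.
  All sums are evaluations at real parameters. One parameter stays free in each, so that comparing
  polynomial coefficients separates the positions; the others are tied by relations under which the
  factors of a spine step and a leaf step differ by 4, which is where the base of the heights comes
  from. In the sum over pairs the two subtrees may be separated by one spine edge or by two
  consecutive ones, so single and double spine steps appear mixed. The chosen relation makes this
  mixture telescope, and what remains are the turns. Going back from turns to steps is not a formal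
  inversion: it needs the leaf step at the end, which rules out paths that keep diverging.\<close>

text \<open>Monomials in the height are evaluated at 4, which is large enough for the sums of at most two
  signed monomials below to be told apart by their values.\<close>

definition height :: "(nat \<Rightarrow> bool) \<Rightarrow> nat \<Rightarrow> nat" where
  "height s i = (\<Sum>j<i. of_bool (s j))"

definition step_weight :: "(nat \<Rightarrow> bool) \<Rightarrow> nat \<Rightarrow> int" where
  "step_weight s i = of_bool (s i) * 4 ^ height s i"

definition turn_weight :: "(nat \<Rightarrow> bool) \<Rightarrow> nat \<Rightarrow> int" where
  "turn_weight s i = (of_bool (s (Suc i)) - of_bool (s i)) * 4 ^ height s i"

lemma height_0 [simp]: "height s 0 = 0"
  by (simp add: height_def)

lemma height_Suc [simp]: "height s (Suc i) = height s i + of_bool (s i)"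
  by (simp add: height_def)

lemma height_add_le: "height s (i + m) \<le> height s i + m"
  by (induction m) (auto simp: of_bool_def)

lemma height_add_less:
  assumes "\<not> s (i + k)" "k < m"
  shows "height s (i + m) < height s i + m"
proof -
  have "height s (i + m) \<le> height s (Suc (i + k)) + (m - Suc k)"
    using height_add_le[of s "Suc (i + k)" "m - Suc k"] assms(2) by simp
  also have "\<dots> \<le> height s i + k + (m - Suc k)"
    using height_add_le[of s i k] assms(1) by simp
  finally show ?thesis using assms(2) by simp
qed

text \<open>The larger exponent is forced: if it were larger on one side, that power alone would be
  at least four times each power of the other side and exceed their sum.\<close>

lemma pow4_sum_eq:
  fixes a b c d :: nat
  assumes "(4::int) ^ a + 4 ^ b = 4 ^ c + 4 ^ d"
  shows "a = c \<and> b = d \<or> a = d \<and> b = c"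
proof -
  have main: "a = c \<and> b = d" if "a \<le> b" "c \<le> d" "(4::int) ^ a + 4 ^ b = 4 ^ c + 4 ^ d" for a b c
      d :: nat
  proof -
    have top: "b \<le> d" if "a \<le> b" "c \<le> d" "(4::int) ^ a + 4 ^ b = 4 ^ c + 4 ^ d" for a b c d :: nat
    proof (rule ccontr)
      assume "\<not> b \<le> d"
      then have "(4::int) ^ Suc d \<le> 4 ^ b" by (intro power_increasing) auto
      moreover have "(4::int) ^ c \<le> 4 ^ d" using that by (intro power_increasing) auto
      moreover have "(0::int) < 4 ^ a" "(0::int) < 4 ^ d" by auto
      ultimately show False using that(3) unfolding power_Suc by linarith
    qed
    have "b = d" using top[OF that] top[OF that(2,1) that(3)[symmetric]] by simp
    with that(3) show ?thesis by simp
  qed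
  consider "a \<le> b" "c \<le> d" | "a \<le> b" "d \<le> c" | "b \<le> a" "c \<le> d" | "b \<le> a" "d \<le> c"
    by linarith
  then show ?thesis
  proof cases
    case 1 then show ?thesis using main[of a b c d] assms by auto
  next
    case 2 then show ?thesis using main[of a b d c] assms by (auto simp: add.commute)
  next
    case 3 then show ?thesis using main[of b a c d] assms by (auto simp: add.commute)
  next
    case 4 then show ?thesis using main[of b a d c] assms by (auto simp: add.commute)
  qed
qed

lemma pow4_bits_eq:
  fixes a b :: nat
  assumes "a \<noteq> b" "of_bool p * (4::int) ^ a + of_bool q * 4 ^ b = of_bool p' * 4 ^ a + of_bool q' * 4
      ^ b"
  shows "p = p' \<and> q = q'"
proof -
  have "(4::int) ^ a \<noteq> 4 ^ b" using assms(1) by simp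
  moreover have "(4::int) ^ a + 4 ^ b \<noteq> 0" by (smt (verit) zero_less_power)
  ultimately show ?thesis using assms(2) by (auto simp: of_bool_def split: if_splits)
qed

text \<open>The only way in which equal turn weights could come with different step weights: at a common
  point one pair of paths crosses and the other one touches. Then the first pair can
  only keep diverging, so that \<open>s\<close> never makes a leaf step again.\<close>

lemma diverging_turns_contradiction:
  assumes T: "\<And>k. Suc k < N \<Longrightarrow> turn_weight s k + turn_weight s' k = turn_weight t k +
      turn_weight t' k"
    and h: "height s i = g" "height s' i = g" "height t i = g" "height t' i = g"
    and i: "Suc i < N" "s i" "s (Suc i)" "\<not> s' i" "\<not> s' (Suc i)"
      "t i" "\<not> t (Suc i)" "\<not> t' i" "t' (Suc i)"
    and last: "\<not> s (N - 1)"
  shows False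
proof -
  have "s (i + m) \<and> height s (i + m) = g + m" if "i + m < N" for m
    using that
  proof (induction m)
    case 0
    then show ?case using h i by simp
  next
    case (Suc m)
    then have IH: "s (i + m)" "height s (i + m) = g + m" by auto
    show ?case
    proof (cases "m = 0")
      case True
      then show ?thesis using h i by simp
    next
      case False
      have s': "height s' (i + m) \<le> g + m - 1"
        using height_add_less[of s' i 0 m] False i h by simp
      have t': "height t' (i + m) \<le> g + m - 1"
        using height_add_less[of t' i 0 m] False i h by simp
      have p: "4 * (4::int) ^ (g + m - 1) = 4 ^ (g + m)"
        using False by (metis Suc_diff_1 add_gr_0 bot_nat_0.not_eq_extremum power_Suc)
      have bound: "\<bar>turn_weight u k\<bar> \<le> 4 ^ (g + m - 1)" if "height u k \<le> g + m - 1" for u k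
        using that power_increasing[of "height u k" "g + m - 1" "4::int"]
        by (auto simp: turn_weight_def of_bool_def)
      \<comment> \<open>For \<open>m = 1\<close> the path \<open>t\<close> is still at height
        \<open>g + 1\<close>, but it makes a leaf step from there, so its turn is not negative; from
        \<open>m = 2\<close> on it lies below \<open>s\<close>.\<close>
      have t: "turn_weight t (i + m) \<ge> - (4 ^ (g + m - 1))"
      proof (cases "m = 1")
        case True
        then show ?thesis using i order_trans[of "- (4 ^ g)" 0 "4 * (4::int) ^ height t i"]
          by (simp add: turn_weight_def)
      next
        case F: False
        then have "height t (i + m) \<le> g + m - 1"
          using height_add_less[of t i 1 m] False i h by simp
        then show ?thesis using bound[of t "i + m"] by linarith
      qed
      \<comment> \<open>A leaf step of \<open>s\<close> would contribute
        \<open>- (4 ^ (g + m))\<close>, and the other three turns can balance at most three quarters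
        of this.\<close>
      have "s (Suc (i + m))"
      proof (rule ccontr)
        assume n: "\<not> s (Suc (i + m))"
        have "turn_weight s (i + m) = - (4 ^ (g + m))"
          using n IH by (simp add: turn_weight_def)
        moreover have "turn_weight s (i + m) + turn_weight s' (i + m) =
            turn_weight t (i + m) + turn_weight t' (i + m)"
          using Suc.prems by (intro T) simp
        moreover have "(0::int) < 4 ^ (g + m - 1)" by simp
        ultimately show False
          using bound[OF s'] bound[OF t'] t p by linarith
      qed
      then show ?thesis using IH by simp
    qed
  qed
  from this[of "N - 1 - i"] show False using i(1) last by simp
qed

lemma height_pow_Suc: "(4::int) ^ height s (Suc i) = 4 ^ height s i + 3 * step_weight s i"
  by (simp add: step_weight_def)

lemma step_weight_eq_of_turn_weight_eq:
  assumes T: "\<And>k. Suc k < N \<Longrightarrow> turn_weight s k + turn_weight s' k = turn_weight t k +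
      turn_weight t' k"
    and first: "\<not> s 0" "\<not> s' 0" "\<not> t 0" "\<not> t' 0"
    and last: "\<not> s (N - 1)" "\<not> s' (N - 1)" "\<not> t (N - 1)" "\<not> t' (N - 1)"
    and "i < N"
  shows "step_weight s i + step_weight s' i = step_weight t i + step_weight t' i"
proof -
  have "step_weight s i + step_weight s' i = step_weight t i + step_weight t' i \<and>
      (4::int) ^ height s i + 4 ^ height s' i = 4 ^ height t i + 4 ^ height t' i"
    using \<open>i < N\<close>
  proof (induction i)
    case 0
    then show ?case using first by (simp add: step_weight_def)
  next
    case (Suc i)
    then have E: "step_weight s i + step_weight s' i = step_weight t i + step_weight t' i"
      and A: "(4::int) ^ height s i + 4 ^ height s' i = 4 ^ height t i + 4 ^ height t' i" by auto
    have A': "(4::int) ^ height s (Suc i) + 4 ^ height s' (Suc i) = 4 ^ height t (Suc i) + 4 ^ height t' (Suc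
        i)"
      unfolding height_pow_Suc using A E by simp
    \<comment> \<open>Stated for arbitrary \<open>t\<close> and \<open>t'\<close>, since the heights
      at \<open>i\<close> agree only up to an exchange of the two paths.\<close>
    have main: "step_weight s (Suc i) + step_weight s' (Suc i) = step_weight t (Suc i) + step_weight t' (Suc i)"
      if h: "height s i = height t i" "height s' i = height t' i"
        and T: "\<And>k. Suc k < N \<Longrightarrow> turn_weight s k + turn_weight s' k = turn_weight t k +
            turn_weight t' k"
        and E: "step_weight s i + step_weight s' i = step_weight t i + step_weight t' i"
        and last: "\<not> t (N - 1)" "\<not> t' (N - 1)"
      for t t'
    proof -
      have Ti: "turn_weight s i + turn_weight s' i = turn_weight t i + turn_weight t' i"
        using T Suc.prems by simp
      \<comment> \<open>Turn weight plus step weight is the next letter, weighted at the current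
        height.\<close>
      have F: "of_bool (s (Suc i)) * (4::int) ^ height s i + of_bool (s' (Suc i)) * 4 ^ height s' i =
          of_bool (t (Suc i)) * 4 ^ height s i + of_bool (t' (Suc i)) * 4 ^ height s' i"
        using Ti E h by (simp add: turn_weight_def step_weight_def algebra_simps)
      have G: "of_bool (s i) * (4::int) ^ height s i + of_bool (s' i) * 4 ^ height s' i =
          of_bool (t i) * 4 ^ height s i + of_bool (t' i) * 4 ^ height s' i"
        using E h by (simp add: step_weight_def)
      show ?thesis
      proof (cases "height s i = height s' i")
        case False
        from pow4_bits_eq[OF False F] pow4_bits_eq[OF False G] h show ?thesis
          by (simp add: step_weight_def)
      next
        case True
        have Tc: "\<And>k. Suc k < N \<Longrightarrow> turn_weight s' k + turn_weight s k = turn_weight t k +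
            turn_weight t' k"
          "\<And>k. Suc k < N \<Longrightarrow> turn_weight s k + turn_weight s' k = turn_weight t' k +
              turn_weight t k"
          "\<And>k. Suc k < N \<Longrightarrow> turn_weight s' k + turn_weight s k = turn_weight t' k +
              turn_weight t k"
          using T by (simp_all add: add.commute)
        have hh: "height s i = height s i" "height s' i = height s i" "height t i = height s i" "height t' i
            = height s i"
          using True h by auto
        \<comment> \<open>At equal heights only the numbers of spine steps are known. One ambiguity
          remains: the spine steps at \<open>i\<close> and \<open>Suc i\<close> may belong to the
          same path or to different ones.\<close>
        have bits: "of_bool (s (Suc i)) + of_bool (s' (Suc i)) = (of_bool (t (Suc i)) + of_bool (t' (Suc i))
            :: int)"
          "of_bool (s i) + of_bool (s' i) = (of_bool (t i) + of_bool (t' i) :: int)"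
          using F G True by (simp_all flip: distrib_right)
        have lastall: "\<not> s (N - 1)" "\<not> s' (N - 1)" "\<not> t (N - 1)" "\<not> t' (N - 1)"
          using last assms(6,7) by auto
        show ?thesis
        proof (rule ccontr)
          assume ne: "step_weight s (Suc i) + step_weight s' (Suc i) \<noteq> step_weight t (Suc i) +
              step_weight t' (Suc i)"
          \<comment> \<open>One configuration suffices; the others arise by exchanging the members
            of a pair or the two pairs.\<close>
          have C: False
            if "\<And>k. Suc k < N \<Longrightarrow> turn_weight a k + turn_weight a' k = turn_weight b k +
                turn_weight b' k"
              "height a i = height s i" "height a' i = height s i" "height b i = height s i" "height b' i =
                  height s i"
              "\<not> a (N - 1)" "a i" "a (Suc i)" "\<not> a' i" "\<not> a' (Suc i)"
              "b i" "\<not> b (Suc i)" "\<not> b' i" "b' (Suc i)" for a a' b b'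
            using diverging_turns_contradiction[of N a a' b b' i "height s i"] that Suc.prems by blast
          from ne bits hh have
            "(s i \<and> s (Suc i) \<and> \<not> s' i \<and> \<not> s' (Suc i) \<or> s' i \<and> s' (Suc i)
                \<and> \<not> s i \<and> \<not> s (Suc i)) \<and>
             (t i \<and> \<not> t (Suc i) \<and> \<not> t' i \<and> t' (Suc i) \<or> t' i \<and> \<not> t'
                 (Suc i) \<and> \<not> t i \<and> t (Suc i)) \<or>
             (t i \<and> t (Suc i) \<and> \<not> t' i \<and> \<not> t' (Suc i) \<or> t' i \<and> t' (Suc i)
                 \<and> \<not> t i \<and> \<not> t (Suc i)) \<and>
             (s i \<and> \<not> s (Suc i) \<and> \<not> s' i \<and> s' (Suc i) \<or> s' i \<and> \<not> s'
                 (Suc i) \<and> \<not> s i \<and> s (Suc i))"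
            by (auto simp: step_weight_def of_bool_def split: if_split_asm)
          then show False
            by (elim disjE conjE) (rule C[of s s' t t'] C[of s s' t' t] C[of s' s t t'] C[of s' s t' t]
              C[of t t' s s'] C[of t' t s s'] C[of t t' s' s] C[of t' t s' s];
              (use T Tc hh lastall in \<open>simp add: add.commute; fail\<close>))+
        qed
      qed
    qed
    from pow4_sum_eq[OF A] show ?case
    proof
      assume "height s i = height t i \<and> height s' i = height t' i"
      then show ?thesis using main[of t t'] T E A' last by auto
    next
      assume "height s i = height t' i \<and> height s' i = height t i"
      then have "step_weight s (Suc i) + step_weight s' (Suc i) = step_weight t' (Suc i) + step_weight t (Suc
          i)"
        using T E last by (intro main) (auto simp: add.commute)
      then show ?thesis using A' by simp
    qed
  qed
  then show ?thesis ..
qed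

section \<open>Words and their reversals\<close>

definition letter :: "bool list \<Rightarrow> nat \<Rightarrow> bool" where
  "letter w i \<longleftrightarrow> i < length w \<and> w ! i"

lemma letter_rev: "i < length w \<Longrightarrow> letter (rev w) i \<longleftrightarrow> letter w (length w -
    1 - i)"
  by (auto simp: letter_def rev_nth)

lemma height_letter: "i \<le> length w \<Longrightarrow> height (letter w) i = count_list (take i w) True"
  by (induction i) (auto simp: take_Suc_conv_app_nth letter_def)

lemma count_list_take_drop: "count_list (take i w) x + count_list (drop i w) x = count_list w x"
  by (metis append_take_drop_id count_list_append)

lemma height_letter_rev:
  assumes "i < length w"
  shows "height (letter w) (Suc (length w - 1 - i)) + height (letter (rev w)) i = count_list w True"
proof -
  have "count_list (take i (rev w)) True = count_list (drop (length w - i) w) True"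
    by (simp add: take_rev count_list_rev)
  then show ?thesis
    using assms count_list_take_drop[of "length w - i" w True] by (simp add: height_letter Suc_diff_Suc)
qed

text \<open>The spine steps before a given one, the step itself (the factor 4) and those after it
  make up all spine steps. Hence the weight at a position of \<open>w\<close> and the weight of its
  mirror image in \<open>rev w\<close> fix each other.\<close>

lemma step_weight_rev_mult:
  assumes "i < length w"
  shows "step_weight (letter w) (length w - 1 - i) * step_weight (letter (rev w)) i * 4 =
    of_bool (letter (rev w) i) * 4 ^ count_list w True"
proof -
  have "letter w (length w - 1 - i) = letter (rev w) i"
    using letter_rev assms by simp
  then show ?thesis
    using height_letter_rev[OF assms, symmetric] by (auto simp: step_weight_def power_add)
qed

lemma step_weight_eq_0_iff [simp]: "step_weight s i = 0 \<longleftrightarrow> \<not> s i"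
  by (simp add: step_weight_def)

text \<open>Take the first i where the path differs from its reversal and the first j where the path of
  \<open>v\<close> follows the reversal instead. By symmetry \<open>i + j\<close> is in range, and in the sum
      with
  \<open>m = i + j\<close> exactly the pieces bounded by these two steps change.\<close>

lemma word_eq_or_rev:
  fixes w v :: "bool list"
  assumes len: "length v = length w" and count: "count_list v True = count_list w True"
    and E: "\<And>i. i < length w \<Longrightarrow>
      (step_weight (letter v) i = step_weight (letter w) i \<and>
        step_weight (letter (rev v)) i = step_weight (letter (rev w)) i) \<or>
      (step_weight (letter v) i = step_weight (letter (rev w)) i \<and>
        step_weight (letter (rev v)) i = step_weight (letter w) i)"
    and I: "\<And>m. Suc m < length w \<Longrightarrow>
      (\<Sum>j\<le>m. step_weight (letter w) j * step_weight (letter (rev w)) (m - j)) =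
      (\<Sum>j\<le>m. step_weight (letter v) j * step_weight (letter (rev v)) (m - j))"
  shows "v = w \<or> v = rev w"
proof -
  define N where "N = length w"
  have same: "u = w" if "length u = N" "\<And>i. i < N \<Longrightarrow> step_weight (letter u) i =
      step_weight (letter w) i" for u
  proof (rule nth_equalityI)
    show "length u = length w" using that N_def by simp
    fix i assume "i < length u"
    then have "step_weight (letter u) i = 0 \<longleftrightarrow> step_weight (letter w) i = 0" using that by
        simp
    then show "u ! i = w ! i" using \<open>i < length u\<close> that(1) N_def by (simp add: letter_def)
  qed
  define e e' where "e = step_weight (letter w)" and "e' = step_weight (letter (rev w))"
  show ?thesis
  proof (cases "\<exists>i<N. e i \<noteq> e' i")
    case False
    then show ?thesis using E same[of v] len by (auto simp: N_def e_def e'_def)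
  next
    case True
    define i where "i = (LEAST i. i < N \<and> e i \<noteq> e' i)"
    have i: "i < N" "e i \<noteq> e' i"
      using LeastI_ex[OF True] unfolding i_def by blast+
    have i_min: "e k = e' k" if "k < i" for k
      using not_less_Least[OF that[unfolded i_def]] that i(1) by linarith
    \<comment> \<open>Replacing \<open>v\<close> by its reversal if necessary, the word may be
      assumed to follow \<open>w\<close> at position \<open>i\<close>.\<close>
    have main: "u = w" if u: "length u = N" "count_list u True = count_list w True"
        "\<And>i. i < N \<Longrightarrow> (step_weight (letter u) i = e i \<and> step_weight (letter (rev u))
            i = e' i) \<or>
          (step_weight (letter u) i = e' i \<and> step_weight (letter (rev u)) i = e i)"
        "step_weight (letter u) i = e i"
        "\<And>m. Suc m < N \<Longrightarrow> (\<Sum>j\<le>m. e j * e' (m - j)) =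
          (\<Sum>j\<le>m. step_weight (letter u) j * step_weight (letter (rev u)) (m - j))" for u
    proof (rule ccontr)
      assume "u \<noteq> w"
      define f f' where "f = step_weight (letter u)" and "f' = step_weight (letter (rev u))"
      have ff: "(f k = e k \<and> f' k = e' k) \<or> (f k = e' k \<and> f' k = e k)" if "k < N" for k
        using u(3)[OF that] by (simp add: f_def f'_def)
      have ex: "\<exists>j<N. f j \<noteq> e j" using \<open>u \<noteq> w\<close> same[of u] u(1) by (auto
          simp: f_def e_def)
      define j where "j = (LEAST j. j < N \<and> f j \<noteq> e j)"
      have j: "j < N" "f j \<noteq> e j"
        using LeastI_ex[OF ex] unfolding j_def by blast+
      have below: "f k = e k" "f' k = e' k" if "k < j" for k
      proof -
        show "f k = e k" using not_less_Least[OF that[unfolded j_def]] that j(1) by linarith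
        then show "f' k = e' k" using ff[of k] that j(1) by auto
      qed
      have fj: "f j = e' j" "f' j = e j" "e j \<noteq> e' j" using ff[OF j(1)] j(2) by auto
      have "i < j"
        using fj(3) i_min[of j] j(2) u(4) by (cases i j rule: linorder_cases) (auto simp: f_def)
      have mult: "e (N - 1 - k) * e' k * 4 = of_bool (e' k \<noteq> 0) * 4 ^ count_list w True"
        "f (N - 1 - k) * f' k * 4 = of_bool (f' k \<noteq> 0) * 4 ^ count_list w True" if "k < N" for k
        using step_weight_rev_mult[of k w] step_weight_rev_mult[of k u] that u(1,2)
        by (simp_all add: e_def e'_def f_def f'_def N_def)
      have zero: "e (N - 1 - k) = 0 \<longleftrightarrow> e' k = 0" "f (N - 1 - k) = 0 \<longleftrightarrow>
          f' k = 0" if "k < N" for k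
        using that u(1) by (simp_all add: e_def e'_def f_def f'_def N_def letter_rev)
      \<comment> \<open>If the weight at the mirror position were unchanged, the product relation
        would give \<open>f' j = e' j\<close>, against the choice of \<open>j\<close>. So a change
        at \<open>j\<close> forces one at \<open>N - 1 - j\<close>, and by minimality
        \<open>j\<close> lies in the first half.\<close>
      have "f (N - 1 - j) \<noteq> e (N - 1 - j)"
      proof
        assume eq: "f (N - 1 - j) = e (N - 1 - j)"
        show False
        proof (cases "e (N - 1 - j) = 0")
          case True
          then show ?thesis using zero[OF j(1)] eq fj by simp
        next
          case False
          then have "e' j \<noteq> 0" "f' j \<noteq> 0" using zero[OF j(1)] eq by auto
          then have "e (N - 1 - j) * e' j * 4 = 4 ^ count_list w True"
            "e (N - 1 - j) * f' j * 4 = 4 ^ count_list w True"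
            using mult[OF j(1)] eq by simp_all
          then have "e (N - 1 - j) * e' j = e (N - 1 - j) * f' j" by linarith
          then show ?thesis using False fj by simp
        qed
      qed
      then have "j \<le> N - 1 - j" using below(1)[of "N - 1 - j"] by (meson not_le_imp_less)
      then have m: "Suc (i + j) < N" using \<open>i < j\<close> by linarith
      define m where "m = i + j"
      \<comment> \<open>A symmetrised term is not affected by an exchange at \<open>k\<close> when
        the two weights at \<open>m - k\<close> coincide; this disposes of all \<open>k\<close> with
        \<open>k < i\<close> or \<open>m - k < i\<close>.\<close>
      have S: "2 * (\<Sum>k\<le>m. a k * b (m - k)) = (\<Sum>k\<le>m. a k * b (m - k) + a (m - k) * b k)" for
          a b :: "nat \<Rightarrow> int"
      proof -
        have "(\<Sum>k\<le>m. a k * b (m - k)) = (\<Sum>k\<le>m. a (m - k) * b k)"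
          by (rule sum.reindex_bij_witness[of _ "\<lambda>k. m - k" "\<lambda>k. m - k"]) auto
        then show ?thesis by (simp add: sum.distrib)
      qed
      \<comment> \<open>The change of the symmetrised term at \<open>i\<close> and \<open>j\<close>
        when the weights at \<open>j\<close> are exchanged and those at \<open>i\<close> are
        kept.\<close>
      let ?d = "(e i - e' i) * (e j - e' j)"
      have term_eq: "f k * f' (m - k) + f (m - k) * f' k =
          e k * e' (m - k) + e (m - k) * e' k + of_bool (k = i \<or> k = j) * ?d" if "k \<le> m" for k
      proof -
        have kN: "k < N" "m - k < N" using that m by (auto simp: m_def)
        consider "k = i" | "k = j" | "k < i" | "m - k < i" | "k \<noteq> i" "k \<noteq> j" "k < j" "m - k < j"
        proof (cases k i rule: linorder_cases)
          case greater
          then show ?thesis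
            using that(1,2,4,5) \<open>k \<le> m\<close> unfolding m_def
            by (cases k j rule: linorder_cases) (simp_all add: less_diff_conv2)
        qed (use that in auto)
        then show ?thesis
        proof cases
          case 1
          then show ?thesis using below[of i] \<open>i < j\<close> fj by (simp add: m_def algebra_simps)
        next
          case 2
          then show ?thesis using below[of i] \<open>i < j\<close> fj by (simp add: m_def algebra_simps)
        next
          case 3
          then have "e k = e' k" "f k = e k" "f' k = e' k" "k \<noteq> j" using i_min below \<open>i <
              j\<close> by auto
          then show ?thesis using ff[OF kN(2)] 3 by (auto simp: algebra_simps)
        next
          case 4
          then have "e (m - k) = e' (m - k)" "f (m - k) = e (m - k)" "f' (m - k) = e' (m - k)" "k \<noteq> j"
              "k \<noteq> i"
            using i_min below \<open>i < j\<close> by (auto simp: m_def)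
          then show ?thesis using ff[OF kN(1)] by (auto simp: algebra_simps)
        next
          case 5
          then show ?thesis using below by simp
        qed
      qed
      have "(\<Sum>k\<le>m. f k * f' (m - k) + f (m - k) * f' k) =
          (\<Sum>k\<le>m. e k * e' (m - k) + e (m - k) * e' k) + (\<Sum>k\<le>m. of_bool (k = i \<or> k = j)
              * ?d)"
        using term_eq by (simp add: sum.distrib)
      then have "(\<Sum>k\<le>m. of_bool (k = i \<or> k = j) * ?d) = 0"
        using u(5)[of m] m S[of e e'] S[of f f'] by (simp add: m_def f_def f'_def)
      moreover have "(\<Sum>k\<le>m. of_bool (k = i \<or> k = j) * ?d) = (\<Sum>k\<in>{i, j}. ?d)"
        by (rule sum.mono_neutral_cong_right) (auto simp: m_def)
      ultimately show False using i(2) fj(3) \<open>i < j\<close> by simp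
    qed
    have I': "(\<Sum>j\<le>m. e j * e' (m - j)) =
        (\<Sum>j\<le>m. step_weight (letter (rev v)) j * step_weight (letter (rev (rev v))) (m - j))" if "Suc
            m < N" for m
    proof -
      have "(\<Sum>j\<le>m. step_weight (letter (rev v)) j * step_weight (letter v) (m - j)) =
          (\<Sum>j\<le>m. step_weight (letter v) j * step_weight (letter (rev v)) (m - j))"
        by (rule sum.reindex_bij_witness[of _ "\<lambda>j. m - j" "\<lambda>j. m - j"]) auto
      then show ?thesis using I[of m] that by (simp add: e_def e'_def N_def)
    qed
    have "i < length w" using i(1) N_def by simp
    from E[OF this] show ?thesis
    proof
      assume "step_weight (letter v) i = step_weight (letter w) i \<and>
        step_weight (letter (rev v)) i = step_weight (letter (rev w)) i"
      then have "v = w"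
        using main[of v] E I len count by (auto simp: e_def e'_def N_def)
      then show ?thesis ..
    next
      assume "step_weight (letter v) i = step_weight (letter (rev w)) i \<and>
        step_weight (letter (rev v)) i = step_weight (letter w) i"
      then have "rev v = w"
        using main[of "rev v"] E I' len count by (auto simp: e_def e'_def N_def count_list_rev)
      then show ?thesis by auto
    qed
  qed
qed

section \<open>Sums over edge sets\<close>

text \<open>A state records the components of an edge set of the tree built so far: the multiset of the
  others and the one of the current vertex. All sizes are decreased by one, so that they count edges.
  The head of a word is its latest step.\<close>

type_synonym state = "nat multiset \<times> nat"

fun attach :: "state \<Rightarrow> state" where
  "attach (M, c) = (M, Suc c)"

fun detach :: "bool \<Rightarrow> state \<Rightarrow> state" where
  "detach b (M, c) = (if b then (add_mset c M, 0) else (add_mset 0 M, c))"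

primrec states :: "bool list \<Rightarrow> state multiset" where
  "states [] = {#({#}, 0)#}"
| "states (b # w) = image_mset attach (states w) + image_mset (detach b) (states w)"

definition part_types :: "bool list \<Rightarrow> nat multiset multiset" where
  "part_types w = image_mset (\<lambda>(M, c). add_mset c M) (states w)"

lemma sum_states_Cons:
  fixes f :: "state \<Rightarrow> 'b::comm_monoid_add"
  shows "(\<Sum>s\<in>#states (b # w). f s) = (\<Sum>s\<in>#states w. f (attach s) + f (detach b s))"
  by (simp add: image_mset.compositionality sum_mset.distrib comp_def)

text \<open>Generating function, by number of edges, of the subtrees containing all vertices that
  have been current: spine edges are forced, leaf edges are free.\<close>

primrec piece :: "real \<Rightarrow> bool list \<Rightarrow> real" where
  "piece y [] = 1"
| "piece y (b # w) = (if b then y else 1 + y) * piece y w"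

lemma piece_append: "piece y (v @ w) = piece y v * piece y w"
  by (induction v) auto

lemma piece_rev [simp]: "piece y (rev w) = piece y w"
  by (induction w) (auto simp: piece_append)

lemma piece_eq: "piece y w = y ^ count_list w True * (1 + y) ^ count_list w False"
  by (induction w) auto

lemma piece_take_drop:
  assumes "i < length w"
  shows "piece y (take i w) * (if w ! i then y else 1 + y) * piece y (drop (Suc i) w) = piece y w"
  by (subst (3) id_take_nth_drop[OF assms]) (simp add: piece_append)

text \<open>Summed over the components C, the monomials with exponent \<open>|C| - 1\<close> of z and with
    the number of
  the edges outside C as exponent of y.\<close>

definition subtree_weight :: "real \<Rightarrow> real \<Rightarrow> nat multiset \<Rightarrow> real" where
  "subtree_weight y z M = y ^ sum_mset M * (\<Sum>c\<in>#M. (z / y) ^ c)"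

definition cur_sum :: "real \<Rightarrow> real \<Rightarrow> bool list \<Rightarrow> real" where
  "cur_sum y z w = (\<Sum>(M, c)\<in>#states w. z ^ c * y ^ sum_mset M)"

definition other_sum :: "real \<Rightarrow> real \<Rightarrow> bool list \<Rightarrow> real" where
  "other_sum y z w = (\<Sum>(M, c)\<in>#states w. y ^ c * subtree_weight y z M)"

lemma sum_states_power: "(\<Sum>(M, c)\<in>#states w. y ^ c * y ^ sum_mset M) = (1 + y :: real) ^ length w"
proof (induction w)
  case (Cons b w)
  have "(\<Sum>(M, c)\<in>#states (b # w). y ^ c * y ^ sum_mset M) =
      (\<Sum>s\<in>#states w. (1 + y) * (case s of (M, c) \<Rightarrow> y ^ c * y ^ sum_mset M))"
    unfolding sum_states_Cons
    by (intro arg_cong[of _ _ sum_mset] image_mset_cong) (auto simp: algebra_simps power_add)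
  then show ?case using Cons by (simp flip: sum_mset_distrib_left)
qed simp

text \<open>A leaf edge belongs to the current component or cuts off a single vertex. An absent
  spine edge starts a new current component without edges, and all earlier edges become
  free.\<close>

lemma cur_sum_Cons:
  "cur_sum y z (b # w) = (if b then z * cur_sum y z w + (1 + y) ^ length w else (1 + z) * cur_sum y z w)"
proof -
  have "cur_sum y z (b # w) = (\<Sum>s\<in>#states w. if b
      then z * (case s of (M, c) \<Rightarrow> z ^ c * y ^ sum_mset M) + (case s of (M, c) \<Rightarrow> y ^
          c * y ^ sum_mset M)
      else (1 + z) * (case s of (M, c) \<Rightarrow> z ^ c * y ^ sum_mset M))"
    unfolding cur_sum_def sum_states_Cons
    by (intro arg_cong[of _ _ sum_mset] image_mset_cong) (auto simp: algebra_simps power_add)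
  then show ?thesis
    by (cases b) (simp_all add: sum_mset.distrib sum_states_power cur_sum_def flip: sum_mset_distrib_left)
qed

lemma subtree_weight_add_mset:
  "y \<noteq> 0 \<Longrightarrow> subtree_weight y z (add_mset c M) = y ^ c * subtree_weight y z M + z ^ c *
      y ^ sum_mset M"
  by (simp add: subtree_weight_def power_add power_divide field_simps)

lemma other_sum_Cons:
  assumes "y \<noteq> 0"
  shows "other_sum y z (b # w) = (1 + y) * other_sum y z w + (if b then cur_sum y z w else (1 + y) ^ length w)"
proof -
  have "other_sum y z (b # w) = (\<Sum>s\<in>#states w. (1 + y) * (case s of (M, c) \<Rightarrow> y ^ c *
      subtree_weight y z M) +
     (case s of (M, c) \<Rightarrow> if b then z ^ c * y ^ sum_mset M else y ^ c * y ^ sum_mset M))"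
    unfolding other_sum_def sum_states_Cons
    by (intro arg_cong[of _ _ sum_mset] image_mset_cong)
      (auto simp: algebra_simps subtree_weight_add_mset[OF assms])
  then show ?thesis
    by (cases b) (simp_all add: sum_mset.distrib sum_states_power cur_sum_def other_sum_def flip:
        sum_mset_distrib_left)
qed

lemma sum_subtree_weight:
  assumes "y \<noteq> 0"
  shows "(\<Sum>M\<in>#part_types w. subtree_weight y z M) = cur_sum y z w + other_sum y z w"
proof -
  have "(\<Sum>M\<in>#part_types w. subtree_weight y z M) = (\<Sum>s\<in>#states w.
      (case s of (M, c) \<Rightarrow> z ^ c * y ^ sum_mset M) + (case s of (M, c) \<Rightarrow> y ^ c *
          subtree_weight y z M))"
    unfolding part_types_def image_mset.compositionality comp_def
    by (intro arg_cong[of _ _ sum_mset] image_mset_cong)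
      (auto simp: subtree_weight_add_mset[OF assms])
  then show ?thesis by (simp add: sum_mset.distrib cur_sum_def other_sum_def)
qed

text \<open>The current component reaches back to the first vertex or ends at its nearest absent
  spine edge \<open>i\<close>; the \<open>length w - 1 - i\<close> edges before that one are then
  free.\<close>

lemma cur_sum_eq:
  "cur_sum y z w = piece z w +
    (\<Sum>i<length w. of_bool (w ! i) * piece z (take i w) * (1 + y) ^ (length w - 1 - i))"
proof (induction w)
  case Nil
  then show ?case by (simp add: cur_sum_def)
next
  case (Cons b w)
  then show ?case
    by (cases b) (simp_all add: cur_sum_Cons sum.lessThan_Suc_shift algebra_simps sum_distrib_left
        del: sum.lessThan_Suc sum_of_bool_mult_eq sum_mult_of_bool_eq)
qed

text \<open>A component other than the final current one is left behind at an absent spine edge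
  \<open>j\<close>, with the \<open>j\<close> later edges free, or it is a single leaf, with all
  other edges free.\<close>

lemma other_sum_eq:
  assumes "y \<noteq> 0"
  shows "other_sum y z w = (\<Sum>j<length w. if w ! j then (1 + y) ^ j * cur_sum y z (drop (Suc j) w)
      else (1 + y) ^ (length w - 1))"
proof (induction w)
  case Nil
  then show ?case by (simp add: other_sum_def subtree_weight_def)
next
  case (Cons b w)
  have "(1 + y) * (if w ! j then (1 + y) ^ j * cur_sum y z (drop (Suc j) w) else (1 + y) ^ (length w - 1)) =
      (if w ! j then (1 + y) ^ Suc j * cur_sum y z (drop (Suc j) w) else (1 + y) ^ length w)"
    if "j < length w" for j
    using that by (cases w) auto
  then have "(1 + y) * other_sum y z w = (\<Sum>j<length w. if w ! j
      then (1 + y) ^ Suc j * cur_sum y z (drop (Suc j) w) else (1 + y) ^ length w)"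
    unfolding Cons.IH sum_distrib_left by (intro sum.cong) auto
  then show ?case
    using assms by (simp add: other_sum_Cons sum.lessThan_Suc_shift del: sum.lessThan_Suc cong: if_cong)
qed

lemma sum_mset_diff:
  fixes f g :: "'a \<Rightarrow> 'b::ab_group_add"
  shows "(\<Sum>x\<in>#M. f x - g x) = (\<Sum>x\<in>#M. f x) - (\<Sum>x\<in>#M. g x)"
  by (induction M) simp_all

lemma sum_mset_uminus:
  fixes f :: "'a \<Rightarrow> 'b::ab_group_add"
  shows "(\<Sum>x\<in>#M. - f x) = - (\<Sum>x\<in>#M. f x)"
  by (induction M) simp_all

text \<open>The sum over the edge sets of the weight \<open>pair_weight y u\<close> is the coefficient of
    \<open>p * q\<close> when each
  indeterminate with index \<open>m + 1\<close> is replaced by \<open>p * y ^ m + q * u ^ m + (1 - p - q) *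
      (- 1) ^ m\<close>.
  The base \<open>- 1\<close> cancels all terms in which some edge can be added or removed freely.\<close>

definition mark :: "real \<Rightarrow> nat \<Rightarrow> real" where
  "mark u c = (- u) ^ c - 1"

definition pair_weight :: "real \<Rightarrow> real \<Rightarrow> nat multiset \<Rightarrow> real" where
  "pair_weight y u M = (- 1) ^ sum_mset M *
     ((\<Sum>c\<in>#M. mark y c) * (\<Sum>c\<in>#M. mark u c) - (\<Sum>c\<in>#M. mark y c * mark u c))"

section \<open>Signed sums for pairs of subtrees\<close>

definition cover_sum :: "real \<Rightarrow> bool list \<Rightarrow> real" where
  "cover_sum y w = (\<Sum>(M, c)\<in>#states w. (- 1) ^ sum_mset M * y ^ c)"

text \<open>One subtree is the current component, with parameter \<open>y\<close>; the other is
  marked by \<open>u\<close> among the components already left.\<close>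

definition marked_sum :: "real \<Rightarrow> real \<Rightarrow> bool list \<Rightarrow> real" where
  "marked_sum y u w = (\<Sum>(M, c)\<in>#states w. (- 1) ^ sum_mset M * (\<Sum>c\<in>#M. mark u c) * y ^ c)"

lemma mark_0 [simp]: "mark u 0 = 0"
  by (simp add: mark_def)

lemma mark_sign: "(- 1) ^ c * mark u c = u ^ c - (- 1) ^ c"
  by (simp add: mark_def algebra_simps flip: power_mult_distrib)

lemma cover_sum_Cons: "cover_sum y (b # w) = (if b then y * cover_sum y w + cover_sum (- 1) w else (1 + y) *
    cover_sum y w)"
proof -
  have "cover_sum y (b # w) = (\<Sum>s\<in>#states w. if b
      then y * (case s of (M, c) \<Rightarrow> (- 1) ^ sum_mset M * y ^ c) + (case s of (M, c) \<Rightarrow>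
          (- 1) ^ sum_mset M * (- 1) ^ c)
      else (1 + y) * (case s of (M, c) \<Rightarrow> (- 1) ^ sum_mset M * y ^ c))"
    unfolding cover_sum_def sum_states_Cons
    by (intro arg_cong[of _ _ sum_mset] image_mset_cong) (auto simp: algebra_simps power_add)
  then show ?thesis
    by (cases b) (simp_all add: sum_mset.distrib cover_sum_def flip: sum_mset_distrib_left)
qed

lemma marked_sum_Cons:
  "marked_sum y u (b # w) =
    (if b then y * marked_sum y u w + marked_sum (- 1) u w + cover_sum u w - cover_sum (- 1) w
     else (1 + y) * marked_sum y u w)"
proof -
  have "marked_sum y u (b # w) = (\<Sum>s\<in>#states w. if b
      then y * (case s of (M, c) \<Rightarrow> (- 1) ^ sum_mset M * (\<Sum>c\<in>#M. mark u c) * y ^ c) +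
        (case s of (M, c) \<Rightarrow> (- 1) ^ sum_mset M * (\<Sum>c\<in>#M. mark u c) * (- 1) ^ c) +
        ((case s of (M, c) \<Rightarrow> (- 1) ^ sum_mset M * u ^ c) + - 1 * (case s of (M, c) \<Rightarrow>
            (- 1) ^ sum_mset M * (- 1) ^ c))
      else (1 + y) * (case s of (M, c) \<Rightarrow> (- 1) ^ sum_mset M * (\<Sum>c\<in>#M. mark u c) * y ^ c))"
    unfolding marked_sum_def sum_states_Cons
  proof (intro arg_cong[of _ _ sum_mset] image_mset_cong)
    fix s assume "s \<in># states w"
    obtain M c where s: "s = (M, c)" by (cases s)
    have "(- 1) ^ (c + sum_mset M) * (mark u c + (\<Sum>c\<in>#M. mark u c)) =
        (- 1) ^ sum_mset M * ((- 1) ^ c * mark u c) + (- 1) ^ sum_mset M * (\<Sum>c\<in>#M. mark u c) * (- 1)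
            ^ c"
      by (simp add: power_add algebra_simps)
    then show "(case attach s of (M, c) \<Rightarrow> (- 1) ^ sum_mset M * (\<Sum>c\<in>#M. mark u c) * y ^ c) +
         (case detach b s of (M, c) \<Rightarrow> (- 1) ^ sum_mset M * (\<Sum>c\<in>#M. mark u c) * y ^ c) =
         (if b
          then y * (case s of (M, c) \<Rightarrow> (- 1) ^ sum_mset M * (\<Sum>c\<in>#M. mark u c) * y ^ c) +
            (case s of (M, c) \<Rightarrow> (- 1) ^ sum_mset M * (\<Sum>c\<in>#M. mark u c) * (- 1) ^ c) +
            ((case s of (M, c) \<Rightarrow> (- 1) ^ sum_mset M * u ^ c) + - 1 * (case s of (M, c)
                \<Rightarrow> (- 1) ^ sum_mset M * (- 1) ^ c))
          else (1 + y) * (case s of (M, c) \<Rightarrow> (- 1) ^ sum_mset M * (\<Sum>c\<in>#M. mark u c) * y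
              ^ c))"
      unfolding mark_sign by (simp add: s algebra_simps)
  qed
  then show ?thesis
    by (cases b) (simp_all add: sum_mset.distrib sum_mset_diff marked_sum_def cover_sum_def flip:
        sum_mset_distrib_left)
qed

text \<open>Pairs without the current component cancel: attaching the newest leaf reverses their
  sign, and detaching it preserves them because a single vertex has mark 0. The same edge kills the
  corrections with base \<open>- 1\<close>. In what remains the current component carries either
  \<open>y\<close> or \<open>u\<close>.\<close>

lemma sum_pair_weight:
  "(\<Sum>M\<in>#part_types (False # w). pair_weight y u M) = marked_sum y u (False # w) + marked_sum u y
      (False # w)"
proof -
  define d where "d w = (\<Sum>(M, c)\<in>#states w. (- 1) ^ c * pair_weight y u M)" for w
  have "(\<Sum>M\<in>#part_types v. pair_weight y u M) = (\<Sum>s\<in>#states v.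
      (case s of (M, c) \<Rightarrow> (- 1) ^ c * pair_weight y u M) +
      ((case s of (M, c) \<Rightarrow> (- 1) ^ sum_mset M * (\<Sum>c\<in>#M. mark u c) * y ^ c) +
        - 1 * (case s of (M, c) \<Rightarrow> (- 1) ^ sum_mset M * (\<Sum>c\<in>#M. mark u c) * (- 1) ^ c)) +
      ((case s of (M, c) \<Rightarrow> (- 1) ^ sum_mset M * (\<Sum>c\<in>#M. mark y c) * u ^ c) +
        - 1 * (case s of (M, c) \<Rightarrow> (- 1) ^ sum_mset M * (\<Sum>c\<in>#M. mark y c) * (- 1) ^ c)))"
            for v
    unfolding part_types_def image_mset.compositionality comp_def
  proof (intro arg_cong[of _ _ sum_mset] image_mset_cong)
    fix s assume "s \<in># states v"
    obtain M c where s: "s = (M, c)" by (cases s)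
    have "pair_weight y u (add_mset c M) = (- 1) ^ c * pair_weight y u M +
        (- 1) ^ sum_mset M * (\<Sum>c\<in>#M. mark u c) * ((- 1) ^ c * mark y c) +
        (- 1) ^ sum_mset M * (\<Sum>c\<in>#M. mark y c) * ((- 1) ^ c * mark u c)"
      by (simp add: pair_weight_def power_add algebra_simps)
    then show "pair_weight y u (case s of (M, c) \<Rightarrow> add_mset c M) =
         (case s of (M, c) \<Rightarrow> (- 1) ^ c * pair_weight y u M) +
         ((case s of (M, c) \<Rightarrow> (- 1) ^ sum_mset M * (\<Sum>c\<in>#M. mark u c) * y ^ c) +
          - 1 * (case s of (M, c) \<Rightarrow> (- 1) ^ sum_mset M * (\<Sum>c\<in>#M. mark u c) * (- 1) ^ c)) +
         ((case s of (M, c) \<Rightarrow> (- 1) ^ sum_mset M * (\<Sum>c\<in>#M. mark y c) * u ^ c) +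
          - 1 * (case s of (M, c) \<Rightarrow> (- 1) ^ sum_mset M * (\<Sum>c\<in>#M. mark y c) * (- 1) ^ c))"
      unfolding mark_sign by (simp add: s algebra_simps)
  qed
  then have "(\<Sum>M\<in>#part_types v. pair_weight y u M) =
      d v + (marked_sum y u v - marked_sum (- 1) u v) + (marked_sum u y v - marked_sum (- 1) y v)" for v
    unfolding sum_mset.distrib d_def marked_sum_def
    by (simp add: sum_mset_uminus flip: sum_mset_distrib_left)
  moreover have "d (False # w) = (\<Sum>s\<in>#states w. 0)"
    unfolding d_def sum_states_Cons
    by (intro arg_cong[of _ _ sum_mset] image_mset_cong) (auto simp: pair_weight_def)
  ultimately show ?thesis by (simp add: marked_sum_Cons)
qed

lemma cover_sum_minus_1: "w \<noteq> [] \<Longrightarrow> cover_sum (- 1) w = 0"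
  by (induction w) (auto simp: cover_sum_Cons)

lemma cover_sum_Nil [simp]: "cover_sum y [] = 1"
  by (simp add: cover_sum_def)

lemma marked_sum_Nil [simp]: "marked_sum y u [] = 0"
  by (simp add: marked_sum_def)

text \<open>A cut at a spine edge leaves earlier edges whose signs cancel; there always are some,
  because the earliest step \<open>last w\<close> is a leaf step. Only the component reaching back
  to the first vertex survives.\<close>

lemma cover_sum_eq:
  assumes "w \<noteq> []" "\<not> last w"
  shows "cover_sum y w = piece y w"
  using assms
proof (induction w)
  case (Cons b w)
  then show ?case by (cases "w = []") (auto simp: cover_sum_Cons cover_sum_minus_1)
qed simp

lemma piece_minus_1: "w \<noteq> [] \<Longrightarrow> \<not> last w \<Longrightarrow> piece (- 1) w = 0"
  using cover_sum_eq cover_sum_minus_1 by metis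

lemma marked_sum_minus_1:
  assumes "w \<noteq> []" "\<not> last w"
  shows "marked_sum (- 1) u w = (if hd w then piece u (tl w) else 0)"
proof (cases w)
  case (Cons b v)
  then show ?thesis
    using assms by (cases "v = []") (auto simp: marked_sum_Cons cover_sum_eq piece_minus_1)
qed (use assms in simp)

text \<open>By cancellation no edge may be missed by both subtrees. So each fills its side of the
  word, and between them lies one absent spine edge \<open>i\<close>, or two consecutive ones
  \<open>i\<close> and \<open>Suc i\<close> whose common vertex carries no leaf.\<close>

lemma marked_sum_eq:
  assumes "w \<noteq> []" "\<not> last w"
  shows "marked_sum y u w = (\<Sum>i<length w. if w ! i then piece y (take i w) *
     (piece u (drop (Suc i) w) + (if letter w (Suc i) then piece u (drop (Suc (Suc i)) w) else 0)) else 0)"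
  using assms
proof (induction w)
  case (Cons b w)
  show ?case
  proof (cases "w = []")
    case True
    then show ?thesis using Cons.prems by (simp add: marked_sum_Cons)
  next
    case False
    then have w: "w \<noteq> []" "\<not> last w" using Cons.prems by auto
    then have *: "piece u w + (if hd w then piece u (tl w) else 0) =
        marked_sum (- 1) u w + cover_sum u w - cover_sum (- 1) w"
      by (simp add: marked_sum_minus_1 cover_sum_eq piece_minus_1)
    have [simp]: "letter (c # w) (Suc i) = letter w i" for c i by (simp add: letter_def)
    have [simp]: "letter w 0 = hd w" "drop (Suc 0) w = tl w"
      using w by (simp_all add: letter_def hd_conv_nth drop_Suc)
    have "(if b then y else 1 + y) * marked_sum y u w =
       (\<Sum>i<length w. if w ! i then piece y (take (Suc i) (b # w)) *
     (piece u (drop (Suc i) w) + (if letter w (Suc i) then piece u (drop (Suc (Suc i)) w) else 0)) else 0)"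
      unfolding Cons.IH[OF w] sum_distrib_left by (intro sum.cong) auto
    then show ?thesis using *
      by (cases b) (simp_all add: marked_sum_Cons sum.lessThan_Suc_shift del: sum.lessThan_Suc cong: if_cong)
  qed
qed simp

text \<open>Both kinds of separation look the same from either end; only the roles of
  \<open>y\<close> and \<open>u\<close> are exchanged.\<close>

lemma marked_sum_rev:
  assumes "w \<noteq> []" "\<not> last w" "\<not> hd w"
  shows "marked_sum u y w = marked_sum y u (rev w)"
proof -
  define N where "N = length w"
  have split: "marked_sum y u v = (\<Sum>i<length v. if v ! i then piece y (take i v) * piece u (drop (Suc i)
      v) else 0) +
      (\<Sum>i<length v - 1. if v ! i \<and> v ! Suc i then piece y (take i v) * piece u (drop (Suc (Suc i))
          v) else 0)"
    if "v \<noteq> []" "\<not> last v" for v y u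
  proof -
    have "(\<Sum>i<length v. if v ! i \<and> letter v (Suc i) then piece y (take i v) * piece u (drop (Suc
        (Suc i)) v) else 0) =
       (\<Sum>i<length v - 1. if v ! i \<and> v ! Suc i then piece y (take i v) * piece u (drop (Suc (Suc i))
           v) else 0)"
      by (rule sum.mono_neutral_cong_right) (auto simp: letter_def)
    moreover have "marked_sum y u v =
      (\<Sum>i<length v. (if v ! i then piece y (take i v) * piece u (drop (Suc i) v) else 0) +
         (if v ! i \<and> letter v (Suc i) then piece y (take i v) * piece u (drop (Suc (Suc i)) v) else 0))"
      unfolding marked_sum_eq[OF that] by (intro sum.cong) (auto simp: algebra_simps)
    ultimately show ?thesis by (simp add: sum.distrib)
  qed
  have t: "take i (rev w) = rev (drop (N - i) w)" "drop i (rev w) = rev (take (N - i) w)" for i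
    by (simp_all add: N_def take_rev drop_rev)
  have "(\<Sum>i<N. if w ! i then piece u (take i w) * piece y (drop (Suc i) w) else 0) =
      (\<Sum>i<N. if rev w ! i then piece y (take i (rev w)) * piece u (drop (Suc i) (rev w)) else 0)"
    by (rule sum.reindex_bij_witness[of _ "\<lambda>i. N - Suc i" "\<lambda>i. N - Suc i"])
      (auto simp: t rev_nth N_def[symmetric] Suc_diff_Suc)
  moreover have "(\<Sum>i<N - 1. if w ! i \<and> w ! Suc i then piece u (take i w) * piece y (drop (Suc (Suc
      i)) w) else 0) =
      (\<Sum>i<N - 1. if rev w ! i \<and> rev w ! Suc i then piece y (take i (rev w)) * piece u (drop (Suc
          (Suc i)) (rev w)) else 0)"
    by (rule sum.reindex_bij_witness[of _ "\<lambda>i. N - Suc (Suc i)" "\<lambda>i. N - Suc (Suc i)"])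
      (auto simp: t rev_nth N_def[symmetric] Suc_diff_Suc numeral_2_eq_2)
  ultimately show ?thesis
    using assms split[of w u y] split[of "rev w" y u] by (simp add: last_rev N_def)
qed

definition normal_word :: "bool list \<Rightarrow> bool" where
  "normal_word w \<longleftrightarrow> w = [] \<or> \<not> hd w \<and> \<not> last w"

section \<open>A word is determined by its component sizes\<close>

text \<open>The parameters are chosen such that a spine step and a leaf step contribute \<open>4 * l\<close>
    and \<open>l\<close> times
  as much to the one piece as to the other. So l marks the position and 4 the height.\<close>

lemma piece_scale:
  assumes "u = 4 * l * y" "1 + u = l * (1 + y)"
  shows "piece u w = l ^ length w * 4 ^ count_list w True * piece y w"
  using assms by (induction w) auto

text \<open>Powers of 4 are 1 modulo 3, so the sum reveals how many of the two weights are nonzero;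
  if both are, \<open>pow4_sum_eq\<close> identifies the exponents.\<close>

lemma step_weight_pair_eq:
  assumes "step_weight s i + step_weight s' i = step_weight t i + step_weight t' i"
  shows "step_weight t i = step_weight s i \<and> step_weight t' i = step_weight s' i \<or>
    step_weight t i = step_weight s' i \<and> step_weight t' i = step_weight s i"
proof -
  have two: "(4::int) ^ a + 4 ^ b \<noteq> 4 ^ c" for a b c
  proof
    assume "(4::int) ^ a + 4 ^ b = 4 ^ c"
    moreover have mod: "(4::int) ^ n mod 3 = 1" for n
      by (induction n) (simp_all, presburger)
    then have "((4::int) ^ a + 4 ^ b) mod 3 = (1 + 1) mod 3"
      by (metis mod_add_eq)
    ultimately show False using mod[of c] by simp
  qed
  have pos: "(4::int) ^ a + 4 ^ b \<noteq> 0" "(4::int) ^ a \<noteq> 0" for a b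
    by (smt (verit) zero_less_power)+
  show ?thesis
    using assms two pos pow4_sum_eq[of "height s i" "height s' i" "height t i" "height t' i"]
      two[symmetric] pos[symmetric]
    unfolding step_weight_def by (cases "s i"; cases "s' i"; cases "t i"; cases "t' i") auto
qed

text \<open>The contribution of two subtrees separated by two consecutive spine edges.\<close>

definition double_step :: "(nat \<Rightarrow> bool) \<Rightarrow> nat \<Rightarrow> int" where
  "double_step s i = of_bool (s i \<and> s (Suc i)) * 4 ^ height s i"

lemma step_weight_Suc: "step_weight s (Suc i) = turn_weight s i + step_weight s i + 3 * double_step s i"
  by (simp add: step_weight_def turn_weight_def double_step_def of_bool_def)

text \<open>Cutting at one or two spine edges removes as many factors \<open>y\<close> from
  \<open>piece y w\<close>, which \<open>y\<^sup>2\<close> restores; rescaling the prefix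
  \<open>take i w\<close> from \<open>u\<close> to \<open>y\<close> leaves \<open>l ^ i\<close> and
  the height.\<close>

lemma marked_sum_scale:
  assumes w: "w \<noteq> []" "\<not> last w" and y: "y \<noteq> 0" "u = 4 * l * y" "1 + u = l * (1 + y)"
  shows "y\<^sup>2 * marked_sum u y w = piece y w *
    (\<Sum>i<length w. l ^ i * (y * of_int (step_weight (letter w) i) + of_int (double_step (letter w) i)))"
  unfolding marked_sum_eq[OF w] sum_distrib_left
proof (rule sum.cong)
  fix i assume "i \<in> {..<length w}"
  then have i: "i < length w" by simp
  show "y\<^sup>2 * (if w ! i then piece u (take i w) * (piece y (drop (Suc i) w) +
      (if letter w (Suc i) then piece y (drop (Suc (Suc i)) w) else 0)) else 0) =
    piece y w * (l ^ i * (y * of_int (step_weight (letter w) i) + of_int (double_step (letter w) i)))"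
  proof (cases "w ! i")
    case True
    have c: "piece u (take i w) = l ^ i * 4 ^ height (letter w) i * piece y (take i w)"
      using i by (simp add: piece_scale[OF y(2,3)] height_letter)
    have p: "piece y (take i w) * y * piece y (drop (Suc i) w) = piece y w"
      using piece_take_drop[OF i, of y] True by simp
    have q: "piece y (drop (Suc i) w) = y * piece y (drop (Suc (Suc i)) w)" if "letter w (Suc i)"
      using that by (simp add: letter_def flip: Cons_nth_drop_Suc)
    have "y\<^sup>2 * (piece u (take i w) * (piece y (drop (Suc i) w) +
        (if letter w (Suc i) then piece y (drop (Suc (Suc i)) w) else 0))) =
      l ^ i * 4 ^ height (letter w) i * (y * (piece y (take i w) * y * piece y (drop (Suc i) w)) +
        (if letter w (Suc i) then piece y (take i w) * y * (y * piece y (drop (Suc (Suc i)) w)) else 0))"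
      by (simp add: c power2_eq_square algebra_simps)
    also have "\<dots> = l ^ i * 4 ^ height (letter w) i * (y * piece y w + of_bool (letter w (Suc i)) *
        piece y w)"
      using p q by (cases "letter w (Suc i)") (simp_all add: algebra_simps)
    finally show ?thesis
      using True i by (simp add: step_weight_def double_step_def letter_def algebra_simps)
  next
    case False
    then show ?thesis using i by (simp add: step_weight_def double_step_def letter_def)
  qed
qed simp

text \<open>By \<open>step_weight_Suc\<close>, three times a double step is the increase of the step
  weight minus the turn; with these coefficients the step weights cancel except at the two
  ends.\<close>

lemma turn_weight_telescope:
  fixes l :: real
  shows "(\<Sum>i<n. l ^ i * ((l - 1) * of_int (step_weight s i) + 3 * l * of_int (double_step s i))) =
    l ^ n * of_int (step_weight s n) - of_int (step_weight s 0) - l * (\<Sum>i<n. of_int (turn_weight s i) *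
        l ^ i)"
  by (induction n) (simp_all add: step_weight_Suc algebra_simps)

lemma letter_length [simp]: "\<not> letter w (length w)"
  by (simp add: letter_def)

lemma letter_0 [simp]: "w \<noteq> [] \<Longrightarrow> letter w 0 \<longleftrightarrow> hd w"
  by (simp add: letter_def hd_conv_nth)

lemma letter_last [simp]: "w \<noteq> [] \<Longrightarrow> letter w (length w - Suc 0) \<longleftrightarrow>
    last w"
  by (simp add: letter_def last_conv_nth)

lemma sum_pair_weight_eq:
  fixes l :: real
  assumes w: "w \<noteq> []" "\<not> hd w" "\<not> last w" and l: "l > 1"
    and y: "y = (l - 1) / (3 * l)" "u = 4 * l * y"
  shows "3 * y\<^sup>2 * (\<Sum>M\<in>#part_types w. pair_weight y u M) =
    - piece y w * (\<Sum>i<length w. of_int (turn_weight (letter w) i + turn_weight (letter (rev w)) i) * l ^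
        i)"
proof -
  have y0: "y \<noteq> 0" using l y by simp
  have u: "1 + u = l * (1 + y)" using l y by (simp add: field_simps)
  \<comment> \<open>Eliminating \<open>u\<close> from the two scaling relations gives this equation,
    hence the value of \<open>y\<close>. It yields exactly the coefficients that telescope.\<close>
  have 3: "3 * l * y = l - 1" using l y by simp
  obtain w' where w': "w = False # w'" using w by (cases w) auto
  have *: "3 * y\<^sup>2 * marked_sum u y v = - piece y v * (\<Sum>i<length v. of_int (turn_weight (letter v)
      i) * l ^ i)"
    if v: "v \<noteq> []" "\<not> hd v" "\<not> last v" for v
  proof -
    have "l * (3 * y\<^sup>2 * marked_sum u y v) = 3 * l * (y\<^sup>2 * marked_sum u y v)" by simp
    also have "\<dots> = piece y v * (\<Sum>i<length v. l ^ i *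
        (3 * l * y * of_int (step_weight (letter v) i) + 3 * l * of_int (double_step (letter v) i)))"
      unfolding marked_sum_scale[OF v(1,3) y0 y(2) u]
      by (simp add: sum_distrib_left algebra_simps)
    \<comment> \<open>The boundary terms vanish: position 0 is a leaf step and position
      \<open>length v\<close> lies outside the word.\<close>
    also have "\<dots> = l * (- piece y v * (\<Sum>i<length v. of_int (turn_weight (letter v) i) * l ^ i))"
      unfolding 3 turn_weight_telescope using v by (simp add: step_weight_def)
    finally show ?thesis using l unfolding mult_cancel_left by auto
  qed
  have "marked_sum y u w = marked_sum u y (rev w)"
    using w by (intro marked_sum_rev) auto
  then show ?thesis
    using *[of w] *[of "rev w"] w sum_pair_weight[of y u w']
    by (simp add: w'[symmetric] algebra_simps sum.distrib hd_rev last_rev)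
qed

lemma polyfun_eq_coeffs_gt_1:
  fixes c d :: "nat \<Rightarrow> real"
  assumes "\<And>x. x > 1 \<Longrightarrow> (\<Sum>i<n. c i * x ^ i) = (\<Sum>i<n. d i * x ^ i)" and "k < n"
  shows "c k = d k"
proof (rule ccontr)
  assume "c k \<noteq> d k"
  obtain m where n: "n = Suc m" using \<open>k < n\<close> by (cases n) auto
  have "{1<..} \<subseteq> {x. (\<Sum>i\<le>m. (c i - d i) * x ^ i) = 0}"
    using assms(1) by (auto simp: n lessThan_Suc_atMost left_diff_distrib sum_subtractf)
  moreover have "finite {x. (\<Sum>i\<le>m. (c i - d i) * x ^ i) = 0}"
    using \<open>c k \<noteq> d k\<close> \<open>k < n\<close> n by (intro polyfun_roots_finite[of _ k]) auto
  ultimately show False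
    using infinite_Ioi finite_subset by blast
qed

lemma part_types_size: "M \<in># part_types w \<Longrightarrow> sum_mset M + size M = Suc (length w)"
proof -
  have "(N, c) \<in># states w \<Longrightarrow> sum_mset N + size N + c = length w" for N c
    by (induction w arbitrary: N c) (fastforce split: if_splits)+
  then show "M \<in># part_types w \<Longrightarrow> sum_mset M + size M = Suc (length w)"
    by (fastforce simp: part_types_def)
qed

lemma part_types_nonempty: "part_types w \<noteq> {#}"
proof -
  have "states w \<noteq> {#}" by (induction w) auto
  then show ?thesis by (simp add: part_types_def)
qed

text \<open>For the second sum, \<open>z = 1 / 3\<close> makes \<open>1 + z\<close> equal to \<open>4 *
    z\<close>.\<close>

lemma piece_third: "piece (1 / 3) w = (4 / 3) ^ length w / 4 ^ count_list w True"
  by (induction w) auto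

lemma count_list_split:
  "i < length w \<Longrightarrow> count_list w True = count_list (take i w) True + of_bool (w ! i) +
      count_list (drop (Suc i) w) True"
  by (subst id_take_nth_drop) auto

lemma piece_third_drop:
  assumes "i < length w" "w ! i"
  shows "piece (1 / 3) (drop (Suc i) w) =
    (4 / 3) ^ (length w - 1 - i) * 4 / 4 ^ count_list w True * of_int (step_weight (letter w) i)"
    and "4 ^ count_list (drop (Suc i) w) True * of_int (step_weight (letter w) i) * 4 = (4 ^ count_list w
        True :: real)"
proof -
  show "4 ^ count_list (drop (Suc i) w) True * of_int (step_weight (letter w) i) * 4 = (4 ^ count_list w True
      :: real)"
    using assms by (simp add: count_list_split[OF assms(1)] step_weight_def letter_def height_letter power_add)
  then show "piece (1 / 3) (drop (Suc i) w) =
    (4 / 3) ^ (length w - 1 - i) * 4 / 4 ^ count_list w True * of_int (step_weight (letter w) i)"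
    using assms(1) by (simp add: piece_third field_simps)
qed

text \<open>Indexed by the number \<open>k\<close> of free edges instead of the place of the cut;
  seen from the first vertex, the cut is step \<open>k\<close> of \<open>rev w\<close>.\<close>

lemma cur_sum_third:
  assumes "x = 1 + y"
  shows "cur_sum y (1 / 3) w = piece (1 / 3) w + (\<Sum>k<length w. x ^ k * (4 / 3) ^ (length w - 1 - k) * 4 /
    4 ^ count_list w True * of_int (step_weight (letter (rev w)) k))"
proof -
  define N where "N = length w"
  have "(\<Sum>i<N. of_bool (w ! i) * piece (1 / 3) (take i w) * x ^ (N - 1 - i)) =
     (\<Sum>k<N. of_bool (rev w ! k) * piece (1 / 3) (drop (Suc k) (rev w)) * x ^ k)"
    by (rule sum.reindex_bij_witness[of _ "\<lambda>i. N - Suc i" "\<lambda>i. N - Suc i"])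
      (auto simp: rev_nth N_def[symmetric] Suc_diff_Suc drop_rev)
  also have "\<dots> = (\<Sum>k<N. x ^ k * (4 / 3) ^ (N - 1 - k) * 4 /
    4 ^ count_list w True * of_int (step_weight (letter (rev w)) k))"
  proof (rule sum.cong)
    fix k assume "k \<in> {..<N}"
    then show "of_bool (rev w ! k) * piece (1 / 3) (drop (Suc k) (rev w)) * x ^ k =
      x ^ k * (4 / 3) ^ (N - 1 - k) * 4 / 4 ^ count_list w True * of_int (step_weight (letter (rev w)) k)"
      using piece_third_drop(1)[of k "rev w"]
      by (cases "rev w ! k") (auto simp: N_def count_list_rev step_weight_def letter_def)
  qed simp
  finally show ?thesis unfolding cur_sum_eq N_def assms by simp
qed

text \<open>The exponent of \<open>x = 1 + y\<close> counts the edges left free beyond the cuts. The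
  four terms stand for components reaching from end to end, single leaves, components bounded by one
  spine edge, and those between two; two cuts leave at most \<open>N - 2\<close> free edges.\<close>

lemma sum_subtree_weight_eq:
  fixes w :: "bool list" and x y :: real
  assumes w: "w \<noteq> []" and x: "x = 1 + y" and y: "y \<noteq> 0"
  defines "e \<equiv> \<lambda>i. of_int (step_weight (letter w) i) :: real"
    and "e' \<equiv> \<lambda>i. of_int (step_weight (letter (rev w)) i) :: real"
    and "N \<equiv> length w" and "P \<equiv> 4 ^ count_list w True :: real"
  shows "(\<Sum>M\<in>#part_types w. subtree_weight y (1 / 3) M) =
    (\<Sum>m<N. ((if m = 0 then (4 / 3) ^ N / P else 0) + (if m = N - 1 then count_list w False else 0) +
      (4 / 3) ^ (N - 1 - m) * 4 / P * (e m + e' m) +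
      (if m < N - 1 then (4 / 3) ^ (N - 1 - m) * 12 / P * (\<Sum>j\<le>m. e j * e' (m - j)) else 0)) * x ^ m)"
proof -
  have N: "N > 0" using w by (simp add: N_def)
  have P: "P \<noteq> 0" by (simp add: P_def)
  have "other_sum y (1 / 3) w = (\<Sum>j<N. of_bool (w ! j) * x ^ j * cur_sum y (1 / 3) (drop (Suc j) w)) +
      (\<Sum>j<N. of_bool (\<not> w ! j) * x ^ (N - 1))"
    unfolding other_sum_eq[OF y] sum.distrib[symmetric] N_def x by (intro sum.cong) auto
  also have "(\<Sum>j<N. of_bool (\<not> w ! j) * x ^ (N - 1)) = count_list w False * x ^ (N - 1)"
  proof -
    have "(\<Sum>j<N. of_bool (\<not> w ! j)) = real (count_list w False)"
      unfolding N_def by (induction w) (auto simp: sum.lessThan_Suc_shift simp del: sum.lessThan_Suc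
          sum_of_bool_eq)
    then show ?thesis by (metis (no_types) sum_distrib_right)
  qed
  also have "(\<Sum>j<N. of_bool (w ! j) * x ^ j * cur_sum y (1 / 3) (drop (Suc j) w)) =
     (\<Sum>j<N. (4 / 3) ^ (N - 1 - j) * 4 / P * e j * x ^ j +
       (\<Sum>k<N - 1 - j. (4 / 3) ^ (N - 1 - (j + k)) * 12 / P * (e j * e' k) * x ^ (j + k)))"
  proof (rule sum.cong)
    fix j assume "j \<in> {..<N}"
    then have j: "j < length w" by (simp add: N_def)
    show "of_bool (w ! j) * x ^ j * cur_sum y (1 / 3) (drop (Suc j) w) =
       (4 / 3) ^ (N - 1 - j) * 4 / P * e j * x ^ j +
       (\<Sum>k<N - 1 - j. (4 / 3) ^ (N - 1 - (j + k)) * 12 / P * (e j * e' k) * x ^ (j + k))"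
    proof (cases "w ! j")
      case False
      then show ?thesis by (simp add: e_def step_weight_def letter_def)
    next
      case True
      let ?u = "drop (Suc j) w"
      have Pu: "4 ^ count_list ?u True * e j * 4 = P"
        using piece_third_drop(2)[OF j True] by (simp add: e_def P_def)
      then have Pu': "4 / 4 ^ count_list ?u True = 16 / P * e j"
        using P by (simp add: field_simps)
      have rev_u: "rev ?u = take (N - 1 - j) (rev w)"
        using j by (simp add: rev_drop N_def)
      have e'_u: "of_int (step_weight (letter (rev ?u)) k) = e' k" if "k < N - 1 - j" for k
      proof -
        have "letter (rev ?u) i = letter (rev w) i" if "i \<le> k" for i
          unfolding rev_u using that \<open>k < N - 1 - j\<close> by (auto simp: letter_def N_def)
        then have "height (letter (rev ?u)) k = height (letter (rev w)) k" "letter (rev ?u) k = letter (rev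
            w) k"
          unfolding height_def by (auto intro: sum.cong)
        then show ?thesis by (simp add: e'_def step_weight_def)
      qed
      have "x ^ j * cur_sum y (1 / 3) ?u = x ^ j * piece (1 / 3) ?u +
        (\<Sum>k<N - 1 - j. x ^ j * (x ^ k * (4 / 3) ^ (N - 1 - j - 1 - k) * (4 / 4 ^ count_list ?u True) *
            e' k))"
        unfolding cur_sum_third[OF x] distrib_left sum_distrib_left
        using e'_u by (intro arg_cong2[of _ _ _ _ "(+)"] sum.cong) (auto simp: N_def)
      also have "(\<Sum>k<N - 1 - j. x ^ j * (x ^ k * (4 / 3) ^ (N - 1 - j - 1 - k) * (4 / 4 ^ count_list ?u
          True) * e' k)) =
         (\<Sum>k<N - 1 - j. (4 / 3) ^ (N - 1 - (j + k)) * 12 / P * (e j * e' k) * x ^ (j + k))"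
      proof (rule sum.cong)
        fix k assume "k \<in> {..<N - 1 - j}"
        then have "N - 1 - (j + k) = Suc (N - 1 - j - 1 - k)" by auto
        then have "(4 / 3 :: real) ^ (N - 1 - (j + k)) = 4 / 3 * (4 / 3) ^ (N - 1 - j - 1 - k)"
          by simp
        then show "x ^ j * (x ^ k * (4 / 3) ^ (N - 1 - j - 1 - k) * (4 / 4 ^ count_list ?u True) * e' k) =
          (4 / 3) ^ (N - 1 - (j + k)) * 12 / P * (e j * e' k) * x ^ (j + k)"
          unfolding Pu' by (simp add: power_add)
      qed simp
      finally show ?thesis
        using True piece_third_drop(1)[OF j True] by (simp add: e_def P_def N_def)
    qed
  qed simp
  also have "\<dots> = (\<Sum>j<N. (4 / 3) ^ (N - 1 - j) * 4 / P * e j * x ^ j) +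
      (\<Sum>j<N. \<Sum>k<N - 1 - j. (4 / 3) ^ (N - 1 - (j + k)) * 12 / P * (e j * e' k) * x ^ (j + k))"
    by (rule sum.distrib)
  also have "(\<Sum>j<N. \<Sum>k<N - 1 - j. (4 / 3) ^ (N - 1 - (j + k)) * 12 / P * (e j * e' k) * x ^ (j + k)) =
      (\<Sum>m<N - 1. \<Sum>j\<le>m. (4 / 3) ^ (N - 1 - m) * 12 / P * (e j * e' (m - j)) * x ^ m)"
  proof -
    have "(\<Sum>j<N. \<Sum>k<N - 1 - j. (4 / 3) ^ (N - 1 - (j + k)) * 12 / P * (e j * e' k) * x ^ (j + k)) =
      (\<Sum>(j, k)\<in>{(j, k). j + k < N - 1}. (4 / 3) ^ (N - 1 - (j + k)) * 12 / P * (e j * e' k) * x ^ (j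
          + k))"
      by (subst sum.Sigma) (auto intro!: sum.cong)
    also have "\<dots> = (\<Sum>m<N - 1. \<Sum>j\<le>m. (4 / 3) ^ (N - 1 - m) * 12 / P * (e j * e' (m - j)) *
        x ^ m)"
      unfolding sum.triangle_reindex by (intro sum.cong) auto
    finally show ?thesis .
  qed
  also have "\<dots> = (\<Sum>m<N. (if m < N - 1 then (4 / 3) ^ (N - 1 - m) * 12 / P * (\<Sum>j\<le>m. e j *
      e' (m - j)) else 0) * x ^ m)"
    by (rule sum.mono_neutral_cong_left) (auto simp: sum_distrib_left sum_distrib_right)
  finally have other: "other_sum y (1 / 3) w = (\<Sum>j<N. (4 / 3) ^ (N - 1 - j) * 4 / P * e j * x ^ j) +
     (\<Sum>m<N. (if m < N - 1 then (4 / 3) ^ (N - 1 - m) * 12 / P * (\<Sum>j\<le>m. e j * e' (m - j)) else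
         0) * x ^ m) +
     count_list w False * x ^ (N - 1)" .
  have cur: "cur_sum y (1 / 3) w = (4 / 3) ^ N / P + (\<Sum>m<N. (4 / 3) ^ (N - 1 - m) * 4 / P * e' m * x ^ m)"
    unfolding cur_sum_third[OF x] piece_third by (simp add: N_def P_def e'_def algebra_simps)
  have 1: "(\<Sum>m<N. (if m = 0 then (4 / 3) ^ N / P else 0) * x ^ m) = (4 / 3) ^ N / P"
    using N by (simp add: if_distrib[of "\<lambda>a. a * _"] sum.delta cong: if_cong)
  have 2: "(\<Sum>m<N. (if m = N - 1 then count_list w False else 0) * x ^ m) = count_list w False * x ^ (N -
      1)"
    using N by (simp add: if_distrib[of "\<lambda>a. real a * _"] sum.delta cong: if_cong)
  show ?thesis
    unfolding sum_subtree_weight[OF y] other cur distrib_right sum.distrib 1 2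
    by (simp add: algebra_simps add_divide_distrib sum.distrib)
qed



lemma count_list_True_False: "count_list w True + count_list w False = length w"
  by (induction w) auto

theorem part_types_determine_word:
  assumes eq: "part_types v = part_types w" and "normal_word v" "normal_word w"
  shows "v = w \<or> v = rev w"
proof -
  obtain M where "M \<in># part_types w" using part_types_nonempty by blast
  then have len: "length v = length w"
    using part_types_size[of M w] part_types_size[of M v] eq by simp
  define N where "N = length w"
  have lenv: "length v = N" and lenw: "length w = N" using len by (simp_all add: N_def)
  show ?thesis
  proof (cases "N \<le> 1")
    case True
    then show ?thesis using assms(2,3) lenv lenw
      by (cases v; cases w) (auto simp: normal_word_def)
  next
    case False
    then have N: "N > 1" by simp
    then have w: "w \<noteq> []" "\<not> hd w" "\<not> last w" and v: "v \<noteq> []" "\<not> hd v" "\<not>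
        last v"
      using assms(2,3) lenv lenw by (auto simp: normal_word_def)
    define e where "e u i = (of_int (step_weight (letter u) i) :: real)" for u i
    define c where "c u m = (if m = 0 then (4 / 3) ^ N / 4 ^ count_list u True else 0) +
      (if m = N - 1 then count_list u False else 0) +
      (4 / 3) ^ (N - 1 - m) * 4 / 4 ^ count_list u True * (e u m + e (rev u) m) +
      (if m < N - 1 then (4 / 3) ^ (N - 1 - m) * 12 / 4 ^ count_list u True *
        (\<Sum>j\<le>m. e u j * e (rev u) (m - j)) else 0)" for u m
    have c: "c v m = c w m" if "m < N" for m
    proof (rule polyfun_eq_coeffs_gt_1[OF _ that])
      fix x :: real assume "x > 1"
      then have x: "x = 1 + (x - 1)" "x - 1 \<noteq> 0" by auto
      show "(\<Sum>i<N. c v i * x ^ i) = (\<Sum>i<N. c w i * x ^ i)"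
        using sum_subtree_weight_eq[OF v(1) x] sum_subtree_weight_eq[OF w(1) x]
        unfolding c_def e_def lenv lenw eq by simp
    qed
    have last0: "e u (N - 1) = 0" "e (rev u) (N - 1) = 0" if "length u = N" "u \<noteq> []" "\<not> hd u"
        "\<not> last u" for u
      using that letter_last[of u] letter_last[of "rev u"]
      by (simp_all add: e_def step_weight_def last_rev)
    \<comment> \<open>At \<open>m = N - 1\<close> everything but the number of leaf steps vanishes:
      \<open>N > 1\<close>, and a word and its reversal both end with a leaf step.\<close>
    have "count_list v False = count_list w False"
      using c[of "N - 1"] N last0[OF lenv v] last0[OF lenw w] by (simp add: c_def)
    then have count: "count_list v True = count_list w True"
      using count_list_True_False[of v] count_list_True_False[of w] len by simp
    have turn: "turn_weight (letter w) k + turn_weight (letter (rev w)) k =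
      turn_weight (letter v) k + turn_weight (letter (rev v)) k" if "k < N" for k
    proof -
      have "(of_int (turn_weight (letter v) k + turn_weight (letter (rev v)) k) :: real) =
        of_int (turn_weight (letter w) k + turn_weight (letter (rev w)) k)"
      proof (rule polyfun_eq_coeffs_gt_1[OF _ that])
        fix l :: real assume l: "l > 1"
        define y where "y = (l - 1) / (3 * l)"
        have "y > 0" using l by (simp add: y_def)
        have "piece y v = piece y w" "piece y w \<noteq> 0"
          using count \<open>count_list v False = count_list w False\<close> \<open>y > 0\<close> by
              (simp_all add: piece_eq)
        then show "(\<Sum>i<N. of_int (turn_weight (letter v) i + turn_weight (letter (rev v)) i) * l ^ i) =
          (\<Sum>i<N. of_int (turn_weight (letter w) i + turn_weight (letter (rev w)) i) * l ^ i)"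
          using sum_pair_weight_eq[OF v l y_def refl] sum_pair_weight_eq[OF w l y_def refl]
          unfolding lenv lenw eq by simp
      qed
      then show ?thesis by linarith
    qed
    have E: "step_weight (letter w) i + step_weight (letter (rev w)) i =
      step_weight (letter v) i + step_weight (letter (rev v)) i" if "i < N" for i
    proof (rule step_weight_eq_of_turn_weight_eq[where N = N])
      show "\<not> letter w (N - 1)" "\<not> letter v (N - 1)" "\<not> letter (rev w) (N - 1)" "\<not> letter
          (rev v) (N - 1)"
        using w v letter_last[of w] letter_last[of v] letter_last[of "rev w"] letter_last[of "rev v"] lenv lenw
        by (simp_all add: last_rev)
    qed (use turn that w v in \<open>simp_all add: hd_rev\<close>)
    have Int: "(\<Sum>j\<le>m. step_weight (letter w) j * step_weight (letter (rev w)) (m - j)) =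
      (\<Sum>j\<le>m. step_weight (letter v) j * step_weight (letter (rev v)) (m - j))" if "Suc m < N" for m
    proof -
      \<comment> \<open>The linear part of the coefficient is already known, and subtracting it
        isolates the convolution.\<close>
      have "e v m + e (rev v) m = e w m + e (rev w) m"
        using E[of m] that unfolding e_def by (metis Suc_lessD of_int_add)
      moreover have "m < N" "m < N - Suc 0" "m \<noteq> N - Suc 0" using that by auto
      ultimately have "(\<Sum>j\<le>m. e v j * e (rev v) (m - j)) = (\<Sum>j\<le>m. e w j * e (rev w) (m - j))"
        using c[of m] unfolding c_def count \<open>count_list v False = count_list w False\<close> by simp
      then have "(of_int (\<Sum>j\<le>m. step_weight (letter w) j * step_weight (letter (rev w)) (m - j)) ::
          real) =
        of_int (\<Sum>j\<le>m. step_weight (letter v) j * step_weight (letter (rev v)) (m - j))"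
        by (simp add: e_def)
      then show ?thesis by (simp only: of_int_eq_iff)
    qed
    show ?thesis
    proof (rule word_eq_or_rev[OF len count])
      fix i assume "i < length w"
      then show "(step_weight (letter v) i = step_weight (letter w) i \<and>
          step_weight (letter (rev v)) i = step_weight (letter (rev w)) i) \<or>
        (step_weight (letter v) i = step_weight (letter (rev w)) i \<and>
          step_weight (letter (rev v)) i = step_weight (letter w) i)"
        using step_weight_pair_eq[OF E[of i]] lenw by simp
    qed (use Int lenw in auto)
  qed
qed

section \<open>Caterpillars and words\<close>

text \<open>In \<open>built w V E d c\<close> the first vertex is d and the current one is c.\<close>

inductive built :: "bool list \<Rightarrow> 'a set \<Rightarrow> 'a set set \<Rightarrow> 'a \<Rightarrow> 'a
    \<Rightarrow> bool" where
  built_Nil: "built [] {v} {} v v"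
| built_Cons: "built w V E d c \<Longrightarrow> x \<notin> V \<Longrightarrow>
    built (b # w) (insert x V) (insert {c, x} E) d (if b then x else c)"

lemma built_facts:
  assumes "built w V E d c"
  shows "finite V" "d \<in> V" "c \<in> V" "\<Union>E \<subseteq> V" "finite E"
proof -
  have "finite V \<and> d \<in> V \<and> c \<in> V \<and> \<Union>E \<subseteq> V \<and> finite E"
    using assms by induction auto
  then show "finite V" "d \<in> V" "c \<in> V" "\<Union>E \<subseteq> V" "finite E"
    by auto
qed

text \<open>A step can also be added at the beginning, which makes the construction reversible.\<close>

lemma built_snoc:
  assumes "built w V E d c" "x \<notin> V"
  shows "built (w @ [b]) (insert x V) (insert {d, x} E) (if b then x else d) c"
  using assms
proof (induction rule: built.induct)
  case (built_Nil v)
  then have "x \<noteq> v" by simp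
  show ?case
  proof (cases b)
    case True
    then show ?thesis
      using built_Cons[OF built.built_Nil[of x], of v True] \<open>x \<noteq> v\<close> by (simp add:
          insert_commute)
  next
    case False
    then show ?thesis
      using built_Cons[OF built.built_Nil[of v], of x False] \<open>x \<noteq> v\<close> by (simp add:
          insert_commute)
  qed
next
  case (built_Cons w V E d c y b')
  then have "built ((b' # w) @ [b]) (insert y (insert x V)) (insert {c, y} (insert {d, x} E)) (if b then x
      else d)
      (if b' then y else c)"
    unfolding append_Cons by (intro built.built_Cons) auto
  then show ?case by (simp add: insert_commute)
qed

lemma built_rev: "built w V E d c \<Longrightarrow> built (rev w) V E c d"
proof (induction rule: built.induct)
  case (built_Nil v)
  then show ?case using built.built_Nil by simp
next
  case (built_Cons w V E d c x b)
  then show ?case using built_snoc[OF built_Cons.IH, of x b] by simp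
qed

text \<open>The latest letter only decides which end of the newest edge is current; the graph does
  not depend on it.\<close>

lemma built_set_hd: "built (b # w) V E d c \<Longrightarrow> \<exists>c'. built (b' # w) V E d c'"
  by (erule built.cases) (auto intro: built_Cons)

lemma built_normal:
  assumes "built w V E d c"
  obtains v d' c' where "built v V E d' c'" "normal_word v"
proof (cases "length w \<le> 1")
  case True
  then consider "w = []" | b where "w = [b]" by (cases w) auto
  then show ?thesis
  proof cases
    case 1 then show ?thesis using that assms by (auto simp: normal_word_def)
  next
    case 2 then show ?thesis
      using that[of "[False]"] built_set_hd[of b "[]" V E d c False] assms by (auto simp: normal_word_def)
  qed
next
  case False
  then obtain a v where "w = a # v" "v \<noteq> []" by (cases w) auto
  then obtain u b where w: "w = a # u @ [b]" by (metis rev_exhaust)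
  then obtain c1 where "built (False # u @ [b]) V E d c1"
    using built_set_hd assms by metis
  then have "built (b # rev u @ [False]) V E c1 d"
    using built_rev by fastforce
  then obtain c2 where "built (False # rev u @ [False]) V E c1 c2"
    using built_set_hd by metis
  then show ?thesis
    by (rule that) (simp add: normal_word_def)
qed

text \<open>That current vertices correspond is needed for the induction, since the next edge is
  attached there.\<close>

lemma built_iso:
  assumes "built w V E d c" "built w V' E' d' c'"
  shows "\<exists>h. bij_betw h V V' \<and> h c = c' \<and> E' = (`) h ` E"
  using assms
proof (induction w arbitrary: V E d c V' E' d' c')
  case Nil
  from Nil(1) obtain v where v: "V = {v}" "E = {}" "c = v" by (cases rule: built.cases) auto
  from Nil(2) obtain v' where v': "V' = {v'}" "E' = {}" "c' = v'" by (cases rule: built.cases) auto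
  show ?case by (rule exI[of _ "\<lambda>_. v'"]) (simp add: v v' bij_betw_def)
next
  case (Cons b w)
  from Cons.prems(1) obtain V0 E0 c0 x where 1: "built w V0 E0 d c0" "x \<notin> V0" "V = insert x V0"
      "E = insert {c0, x} E0" "c = (if b then x else c0)"
    by (cases rule: built.cases) auto
  from Cons.prems(2) obtain V0' E0' c0' x' where 2: "built w V0' E0' d' c0'" "x' \<notin> V0'" "V' = insert
      x' V0'"
      "E' = insert {c0', x'} E0'" "c' = (if b then x' else c0')"
    by (cases rule: built.cases) auto
  from Cons.IH[OF 1(1) 2(1)] obtain h where h: "bij_betw h V0 V0'" "h c0 = c0'" "E0' = (`) h ` E0" by blast
  have c0: "c0 \<noteq> x" using built_facts(3)[OF 1(1)] 1(2) by auto
  have "(`) (h(x := x')) ` E0 = (`) h ` E0"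
    using built_facts(4)[OF 1(1)] 1(2) by (intro image_cong) (auto simp: image_iff)
  moreover have "bij_betw (h(x := x')) V V'"
    unfolding 1(3) 2(3) using h(1) 1(2) 2(2)
    by (subst bij_betw_cong[of _ _ "\<lambda>u. if u = x then x' else h u"]) (auto simp: bij_betw_def
        inj_on_def)
  moreover have "(h(x := x')) c = c'"
    using h(2) c0 1(5) 2(5) by simp
  moreover have "(h(x := x')) ` {c0, x} = {c0', x'}"
    using h(2) c0 by simp
  ultimately show ?case
    unfolding 1(4) 2(4) h(3) by (intro exI[of _ "h(x := x')"] conjI) (simp_all only: image_insert)
qed

lemma built_graph_iso:
  assumes "built w V E d c" "built w V' E' d' c'"
  shows "graph_iso V E V' E'"
proof -
  obtain h where h: "bij_betw h V V'" "E' = (`) h ` E"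
    using built_iso[OF assms] by blast
  have "{u, v} \<in> E \<longleftrightarrow> {h u, h v} \<in> E'" if "u \<in> V" "v \<in> V" for u v
  proof
    assume "{h u, h v} \<in> E'"
    then obtain e where e: "e \<in> E" "h ` e = h ` {u, v}" unfolding h(2) by auto
    moreover have "e \<subseteq> V" using built_facts(4)[OF assms(1)] e(1) by auto
    ultimately have "e = {u, v}"
      using h(1) that by (intro inj_on_image_eq_iff[THEN iffD1, of h V]) (auto simp: bij_betw_def)
    then show "{u, v} \<in> E" using e by simp
  next
    assume "{u, v} \<in> E"
    then have "h ` {u, v} \<in> E'" unfolding h(2) by (rule imageI)
    then show "{h u, h v} \<in> E'" by simp
  qed
  then show ?thesis unfolding graph_iso_def using h(1) by blast
qed

section \<open>Components when a vertex is added\<close>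

lemma equiv_reachable: "equiv V (reachable V A)"
proof (rule equivI)
  have "sym ({(x, y). {x, y} \<in> A}\<^sup>*)"
    by (intro sym_rtrancl) (auto simp: sym_def insert_commute)
  then show "sym (reachable V A)" by (auto simp: reachable_def sym_def)
  show "trans (reachable V A)" by (auto simp: reachable_def trans_def)
qed (auto simp: reachable_def refl_on_def)

definition component_of :: "'a set \<Rightarrow> 'a set set \<Rightarrow> 'a \<Rightarrow> 'a set" where
  "component_of V A u = reachable V A `` {u}"

lemma components_eq: "components V A = component_of V A ` V"
  by (auto simp: components_def quotient_def component_of_def)

lemma component_of_self: "u \<in> V \<Longrightarrow> u \<in> component_of V A u"
  by (auto simp: component_of_def reachable_def)

lemma component_of_subset: "component_of V A u \<subseteq> V"
  by (auto simp: component_of_def reachable_def)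

lemma component_of_eq_iff:
  "u \<in> V \<Longrightarrow> v \<in> V \<Longrightarrow> component_of V A u = component_of V A v
      \<longleftrightarrow> u \<in> component_of V A v"
  unfolding component_of_def using equiv_class_eq_iff[OF equiv_reachable[of V A], of v u]
  by (auto simp: reachable_def)

lemma component_of_closed:
  assumes "u \<in> S" "\<And>a b. a \<in> S \<Longrightarrow> {a, b} \<in> A \<Longrightarrow> b \<in> S"
  shows "component_of V A u \<subseteq> S"
proof -
  have "{(x, y). {x, y} \<in> A}\<^sup>* `` S = S"
    using assms(2) by (intro Image_closed_trancl) auto
  then show ?thesis using assms(1) by (auto simp: component_of_def reachable_def)
qed

lemma component_of_step:
  "v \<in> component_of V A u \<Longrightarrow> {v, w} \<in> A \<Longrightarrow> w \<in> V \<Longrightarrow>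
      w \<in> component_of V A u"
  by (auto simp: component_of_def reachable_def intro: rtrancl_into_rtrancl)

lemma component_of_mono:
  assumes "V \<subseteq> V'" "A \<subseteq> A'"
  shows "component_of V A u \<subseteq> component_of V' A' u"
proof -
  have "{(x, y). {x, y} \<in> A}\<^sup>* \<subseteq> {(x, y). {x, y} \<in> A'}\<^sup>*"
    using assms(2) by (intro rtrancl_mono) auto
  then show ?thesis using assms(1) by (auto simp: component_of_def reachable_def)
qed

lemma component_of_insert_isolated:
  assumes "x \<notin> V" "\<Union>A \<subseteq> V"
  shows "u \<in> V \<Longrightarrow> component_of (insert x V) A u = component_of V A u"
    and "component_of (insert x V) A x = {x}"
proof -
  show "component_of (insert x V) A u = component_of V A u" if "u \<in> V"
  proof
    show "component_of (insert x V) A u \<subseteq> component_of V A u"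
      using assms(2) by (intro component_of_closed component_of_self that) (auto intro: component_of_step)
  qed (intro component_of_mono; auto)
  show "component_of (insert x V) A x = {x}"
  proof
    show "component_of (insert x V) A x \<subseteq> {x}"
      using assms by (intro component_of_closed) auto
  qed (use component_of_self[of x "insert x V"] in simp)
qed

lemma component_of_insert_edge:
  assumes "x \<notin> V" "c \<in> V" "\<Union>A \<subseteq> V" "u \<in> insert x V"
  shows "component_of (insert x V) (insert {c, x} A) u =
    (if u = x \<or> u \<in> component_of V A c then insert x (component_of V A c) else component_of V A u)"
proof -
  let ?K = "insert x (component_of V A c)" and ?C = "component_of (insert x V) (insert {c, x} A)"
  have nb: "b \<in> V" "a \<in> V" if "{a, b} \<in> A" for a b using that assms(3) by auto
  have K: "?C v \<subseteq> ?K" if v: "v \<in> ?K" for v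
  proof (rule component_of_closed[OF v])
    fix a b assume a: "a \<in> ?K" and "{a, b} \<in> insert {c, x} A"
    then consider "a = c" "b = x" | "a = x" "b = c" | "{a, b} \<in> A" by (auto simp: doubleton_eq_iff)
    then show "b \<in> ?K"
    proof cases
      case 2
      then show ?thesis using component_of_self[OF assms(2)] by simp
    next
      case 3
      then have "a \<in> component_of V A c" using a nb(2)[OF 3] assms(1) by blast
      then show ?thesis using component_of_step[OF _ 3 nb(1)[OF 3]] by blast
    qed simp
  qed
  have mono: "component_of V A v \<subseteq> ?C v" for v
    by (intro component_of_mono) auto
  have "c \<in> ?C c" using assms(2) by (intro component_of_self) simp
  then have "x \<in> ?C c" by (rule component_of_step) simp_all
  then have "?K \<subseteq> ?C c" using mono[of c] by (rule insert_subsetI)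
  moreover have "?C c \<subseteq> ?K" using component_of_self[OF assms(2)] by (intro K insertI2)
  ultimately have eq: "?C c = ?K" by (rule equalityI[rotated])
  have eq_K: "?C v = ?K" if "v \<in> ?K" for v
  proof -
    have "v \<in> insert x V" using that component_of_subset[of V A c] by blast
    then have "?C v = ?C c"
      using component_of_eq_iff[of v "insert x V" c "insert {c, x} A"] that assms(2) unfolding eq by blast
    then show ?thesis unfolding eq .
  qed
  have other: "?C u = component_of V A u" if u: "u \<notin> ?K"
  proof
    have "u \<in> V" using u assms(4) by blast
    moreover have "c \<notin> component_of V A u"
      using component_of_eq_iff[OF \<open>u \<in> V\<close> assms(2), of A] component_of_eq_iff[OF assms(2)
          \<open>u \<in> V\<close>, of A] u
      by (metis insertI2)
    ultimately show "?C u \<subseteq> component_of V A u"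
    proof (intro component_of_closed component_of_self)
      fix a b assume a: "a \<in> component_of V A u" and "{a, b} \<in> insert {c, x} A"
        and c: "c \<notin> component_of V A u"
      moreover have "a \<noteq> x" using a assms(1) component_of_subset[of V A u] by blast
      ultimately have "{a, b} \<in> A" using c by (auto simp: doubleton_eq_iff)
      then show "b \<in> component_of V A u" using component_of_step[OF a] nb(1) by blast
    qed
  qed (rule mono)
  show ?thesis using eq_K[of u] other by (cases "u \<in> ?K") simp_all
qed

lemma components_insert_isolated:
  assumes "x \<notin> V" "\<Union>A \<subseteq> V"
  shows "components (insert x V) A = insert {x} (components V A)" "{x} \<notin> components V A"
proof -
  show "components (insert x V) A = insert {x} (components V A)"
    using component_of_insert_isolated[OF assms] by (simp add: components_eq)
  have "{x} \<noteq> component_of V A u" for u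
    using component_of_subset[of V A u] assms(1) by blast
  then show "{x} \<notin> components V A" by (auto simp: components_eq)
qed

lemma components_insert_edge:
  assumes "x \<notin> V" "c \<in> V" "\<Union>A \<subseteq> V"
  shows "components (insert x V) (insert {c, x} A) =
    insert (insert x (component_of V A c)) (components V A - {component_of V A c})"
proof -
  let ?K = "component_of V A c"
  have V: "insert x V = insert x ?K \<union> (V - ?K)"
    using component_of_subset[of V A c] by blast
  define f where "f u = (if u = x \<or> u \<in> ?K then insert x ?K else component_of V A u)" for u
  have "components (insert x V) (insert {c, x} A) = f ` insert x V"
    unfolding components_eq f_def by (intro image_cong refl component_of_insert_edge[OF assms])
  also have "f ` insert x V = f ` insert x ?K \<union> f ` (V - ?K)"
    using arg_cong[OF V, of "image f"] image_Un[of f "insert x ?K" "V - ?K"] by (rule trans)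
  also have "f ` insert x ?K = {insert x ?K}"
    by (auto simp: f_def)
  also have "f ` (V - ?K) = component_of V A ` (V - ?K)"
    using assms(1) by (intro image_cong) (auto simp: f_def)
  also have "component_of V A ` (V - ?K) = components V A - {?K}"
  proof -
    have "component_of V A u = ?K \<longleftrightarrow> u \<in> ?K" if "u \<in> V" for u
      using component_of_eq_iff[OF that assms(2)] .
    then show ?thesis unfolding components_eq by blast
  qed
  finally show ?thesis by (simp only: Un_insert_left Un_empty_left)
qed

section \<open>Edge sets of a tree and states of its word\<close>

definition graph_state :: "'a set \<Rightarrow> 'a \<Rightarrow> 'a set set \<Rightarrow> state" where
  "graph_state V c A = (image_mset (\<lambda>C. card C - 1) (mset_set (components V A - {component_of V A c})),
     card (component_of V A c) - 1)"

lemma finite_components: "finite V \<Longrightarrow> finite (components V A)"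
  by (simp add: components_eq)

lemma graph_state_detach:
  assumes "finite V" "x \<notin> V" "c \<in> V" "\<Union>A \<subseteq> V"
  shows "graph_state (insert x V) (if b then x else c) A = detach b (graph_state V c A)"
proof -
  note iso = components_insert_isolated[OF assms(2,4)] component_of_insert_isolated[OF assms(2,4)]
  have c: "component_of V A c \<in> components V A" using assms(3) by (simp add: components_eq)
  have ne: "component_of V A c \<noteq> {x}" using iso(2) c by auto
  show ?thesis
  proof (cases b)
    case True
    have "mset_set (components V A) = add_mset (component_of V A c) (mset_set (components V A - {component_of
        V A c}))"
      by (rule mset_set.remove[OF finite_components[OF assms(1)] c])
    then show ?thesis using True iso by (simp add: graph_state_def)
  next
    case False
    have "insert {x} (components V A) - {component_of V A c} = insert {x} (components V A - {component_of V A
        c})"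
      using ne by auto
    then show ?thesis using False iso assms(1,3) finite_components[of V A] by (simp add: graph_state_def)
  qed
qed

lemma graph_state_attach:
  assumes "finite V" "x \<notin> V" "c \<in> V" "\<Union>A \<subseteq> V"
  shows "graph_state (insert x V) (if b then x else c) (insert {c, x} A) = attach (graph_state V c A)"
proof -
  let ?K = "component_of V A c"
  have K: "x \<notin> ?K" "finite ?K" "c \<in> ?K"
    using component_of_subset[of V A c] assms(2) finite_subset[OF _ assms(1)] component_of_self[OF assms(3),
        of A]
    by blast+
  have cur: "component_of (insert x V) (insert {c, x} A) (if b then x else c) = insert x ?K"
    using component_of_insert_edge[OF assms(2-4), of "if b then x else c"] assms(3) K(3) by auto
  have "insert x ?K \<notin> components V A" using assms(2) component_of_subset[of V A] by (auto simp:
      components_eq)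
  then have "insert (insert x ?K) (components V A - {?K}) - {insert x ?K} = components V A - {?K}" by auto
  moreover have "card ?K > 0" using K by (auto simp: card_gt_0_iff)
  ultimately show ?thesis
    unfolding graph_state_def cur components_insert_edge[OF assms(2-4)] using K by simp
qed

text \<open>This makes the exponent of \<open>var 0 - 1\<close> zero in every term of the
  U-polynomial.\<close>

lemma card_components:
  assumes "built w V E d c" "A \<subseteq> E"
  shows "card A + card (components V A) = card V"
  using assms
proof (induction arbitrary: A rule: built.induct)
  case (built_Nil v)
  then show ?case by (simp add: components_eq)
next
  case (built_Cons w V E d c x b)
  note f = built_facts[OF built_Cons(1)]
  have e: "{c, x} \<notin> E" using f(4) built_Cons(2) by auto
  show ?case
  proof (cases "{c, x} \<in> A")
    case False
    then have A: "A \<subseteq> E" using built_Cons.prems by auto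
    then have "\<Union>A \<subseteq> V" using f(4) by auto
    with built_Cons.IH[OF A] show ?thesis
      using components_insert_isolated[OF built_Cons(2)] finite_components[OF f(1)] built_Cons(2) f(1) by simp
  next
    case True
    define A0 where "A0 = A - {{c, x}}"
    have A0: "A0 \<subseteq> E" "A = insert {c, x} A0" "{c, x} \<notin> A0" "finite A0"
      using True built_Cons.prems f(5) finite_subset by (auto simp: A0_def)
    then have U: "\<Union>A0 \<subseteq> V" using f(4) by auto
    have c: "component_of V A0 c \<in> components V A0" using f(3) by (simp add: components_eq)
    have "insert x (component_of V A0 c) \<notin> components V A0"
      using built_Cons(2) component_of_subset[of V A0] by (auto simp: components_eq)
    then have "card (components (insert x V) A) = card (components V A0)"
      unfolding A0(2) components_insert_edge[OF built_Cons(2) f(3) U]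
      using finite_components[OF f(1), of A0] c card_Suc_Diff1 by fastforce
    then show ?thesis
      using built_Cons.IH[OF A0(1)] A0 built_Cons(2) f(1) by simp
  qed
qed

lemma graph_states:
  "built w V E d c \<Longrightarrow> image_mset (graph_state V c) (mset_set (Pow E)) = states w"
proof (induction rule: built.induct)
  case (built_Nil v)
  have "component_of {v} {} v = {v}"
    using component_of_self[of v "{v}"] component_of_subset[of "{v}" "{}" v] by auto
  then show ?case by (simp add: graph_state_def components_eq)
next
  case (built_Cons w V E d c x b)
  note f = built_facts[OF built_Cons(1)]
  have e: "{c, x} \<notin> E" using f(4) built_Cons(2) by auto
  have inj: "inj_on (insert {c, x}) (Pow E)" using e by (intro inj_onI) (metis PowD insert_ident subsetD)
  \<comment> \<open>Edge sets without the newest edge give the detached states, those with it the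
    attached ones.\<close>
  have "mset_set (Pow (insert {c, x} E)) = mset_set (Pow E) + mset_set (insert {c, x} ` Pow E)"
    unfolding Pow_insert using f(5) e by (intro mset_set_Union) auto
  also have "mset_set (insert {c, x} ` Pow E) = image_mset (insert {c, x}) (mset_set (Pow E))"
    using inj by (simp add: image_mset_mset_set)
  finally have P: "mset_set (Pow (insert {c, x} E)) = mset_set (Pow E) + image_mset (insert {c, x}) (mset_set
      (Pow E))" .
  define c' where "c' = (if b then x else c)"
  have step: "graph_state (insert x V) c' A = detach b (graph_state V c A)"
    "graph_state (insert x V) c' (insert {c, x} A) = attach (graph_state V c A)" if "A \<in># mset_set (Pow
        E)" for A
  proof -
    have "\<Union>A \<subseteq> V" using that f(4,5) by auto
    then show "graph_state (insert x V) c' A = detach b (graph_state V c A)"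
      "graph_state (insert x V) c' (insert {c, x} A) = attach (graph_state V c A)"
      unfolding c'_def using graph_state_detach[OF f(1) built_Cons(2) f(3), of A b]
        graph_state_attach[OF f(1) built_Cons(2) f(3), of A b] by blast+
  qed
  have "image_mset (graph_state (insert x V) c') (mset_set (Pow (insert {c, x} E))) =
      image_mset (\<lambda>A. detach b (graph_state V c A)) (mset_set (Pow E)) +
      image_mset (\<lambda>A. attach (graph_state V c A)) (mset_set (Pow E))"
    unfolding P image_mset_union image_mset.compositionality comp_def
    by (intro arg_cong2[of _ _ _ _ "(+)"] image_mset_cong step)
  then show ?case
    unfolding c'_def states.simps built_Cons.IH[symmetric]
    by (simp add: image_mset.compositionality comp_def add.commute)
qed

text \<open>The index is \<open>Suc m\<close> because sizes are decreased by one; so index 0, that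
  of z, does not occur.\<close>

definition type_monom :: "nat multiset \<Rightarrow> monom" where
  "type_monom M = (\<Sum>m\<in>#M. Poly_Mapping.single (Suc m) 1)"

lemma lookup_type_monom: "Poly_Mapping.lookup (type_monom M) i = (case i of 0 \<Rightarrow> 0 | Suc m
    \<Rightarrow> count M m)"
  by (induction M) (auto simp: type_monom_def lookup_add lookup_single when_def split: nat.splits)

lemma inj_type_monom: "inj type_monom"
proof (rule injI)
  fix M M' assume "type_monom M = type_monom M'"
  then have "Poly_Mapping.lookup (type_monom M) (Suc m) = Poly_Mapping.lookup (type_monom M') (Suc m)" for m
      by simp
  then show "M = M'" by (simp add: lookup_type_monom multiset_eq_iff)
qed

lemma prod_mset_var: "(\<Prod>m\<in>#M. var (Suc m)) = Poly_Mapping.single (type_monom M) 1"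
  by (induction M) (simp_all add: type_monom_def var_def mult_single single_one flip: single_one)

lemma U_polynomial_built:
  assumes "built w V E d c"
  shows "U_polynomial V E = (\<Sum>M\<in>#part_types w. Poly_Mapping.single (type_monom M) 1)"
proof -
  note f = built_facts[OF assms]
  have "(\<Prod>C\<in>components V A. var (card C)) * (var 0 - 1) ^ (card A + card (components V A) - card V) =
      Poly_Mapping.single (type_monom (case graph_state V c A of (M, m) \<Rightarrow> add_mset m M)) 1" if "A
          \<in> Pow E" for A
  proof -
    have c: "component_of V A c \<in> components V A" using f(3) by (simp add: components_eq)
    have fin: "finite (components V A)" by (rule finite_components[OF f(1)])
    have pos: "Suc (card C - 1) = card C" if "C \<in> components V A" for C
    proof -
      from that obtain u where "u \<in> V" "C = component_of V A u" by (auto simp: components_eq)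
      then have "u \<in> C" "finite C"
        using component_of_self[of u V A] finite_subset[OF component_of_subset f(1)] by simp_all
      then have "card C > 0" by (auto simp: card_gt_0_iff)
      then show ?thesis by simp
    qed
    have "mset_set (components V A) = add_mset (component_of V A c) (mset_set (components V A - {component_of
        V A c}))"
      by (rule mset_set.remove[OF fin c])
    then have "(case graph_state V c A of (M, m) \<Rightarrow> add_mset m M) = image_mset (\<lambda>C. card C
        - 1) (mset_set (components V A))"
      by (simp add: graph_state_def)
    then have "Poly_Mapping.single (type_monom (case graph_state V c A of (M, m) \<Rightarrow> add_mset m M))
        1 =
      (\<Prod>C\<in>components V A. var (Suc (card C - 1)))"
      by (simp only: prod_mset_var[symmetric] image_mset.compositionality prod_unfold_prod_mset comp_def)
    also have "\<dots> = (\<Prod>C\<in>components V A. var (card C))"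
      using pos by (intro prod.cong) auto
    finally show ?thesis using card_components[OF assms, of A] that by simp
  qed
  then have "U_polynomial V E = (\<Sum>A\<in>Pow E. Poly_Mapping.single (type_monom (case graph_state V c A
      of (M, m) \<Rightarrow> add_mset m M)) 1)"
    unfolding U_polynomial_def by (intro sum.cong) auto
  also have "\<dots> = (\<Sum>M\<in>#part_types w. Poly_Mapping.single (type_monom M) 1)"
    unfolding part_types_def graph_states[OF assms, symmetric] sum_unfold_sum_mset image_mset.compositionality
    by (simp add: comp_def)
  finally show ?thesis .
qed

lemma lookup_sum_mset_single:
  "Poly_Mapping.lookup (\<Sum>M\<in>#T. Poly_Mapping.single (f M) (1::int)) m = int (count (image_mset f T) m)"
  by (induction T) (auto simp: lookup_add lookup_single when_def)

lemma part_types_eqI: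
  assumes "(\<Sum>M\<in>#part_types v. Poly_Mapping.single (type_monom M) (1::int)) =
    (\<Sum>M\<in>#part_types w. Poly_Mapping.single (type_monom M) 1)"
  shows "part_types v = part_types w"
proof -
  have "int (count (image_mset type_monom (part_types v)) m) = int (count (image_mset type_monom (part_types
      w)) m)" for m
    using assms by (simp flip: lookup_sum_mset_single)
  then have "image_mset type_monom (part_types v) = image_mset type_monom (part_types w)"
    by (simp add: multiset_eq_iff)
  then have "image_mset (inv type_monom) (image_mset type_monom (part_types v)) =
      image_mset (inv type_monom) (image_mset type_monom (part_types w))" by simp
  then show ?thesis
    using inj_type_monom by (simp add: image_mset.compositionality comp_def)
qed

section \<open>Every caterpillar is built by a word\<close>

lemma built_add_leaves:
  assumes "finite X" "built w V E d c" "X \<inter> V = {}"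
  shows "\<exists>w'. built w' (V \<union> X) (E \<union> (\<lambda>x. {c, x}) ` X) d c"
  using assms
proof (induction X)
  case (insert x X)
  then obtain w' where "built w' (V \<union> X) (E \<union> (\<lambda>x. {c, x}) ` X) d c" by blast
  moreover have "x \<notin> V \<union> X" using insert by blast
  ultimately show ?case using built_Cons[of w' "V \<union> X" _ d c x False] by auto
qed auto

lemma path_edges_snoc:
  assumes "vs \<noteq> []"
  shows "path_edges (vs @ [v]) = insert {last vs, v} (path_edges vs)"
proof -
  have "path_edges (vs @ [v]) = (\<lambda>i. {(vs @ [v]) ! i, (vs @ [v]) ! Suc i}) ` {..<length vs}"
    by (auto simp: path_edges_def)
  also have "{..<length vs} = insert (length vs - 1) {..<length vs - 1}"
    using assms by (cases vs) auto
  also note image_insert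
  also have "(\<lambda>i. {(vs @ [v]) ! i, (vs @ [v]) ! Suc i}) ` {..<length vs - 1} = (\<lambda>i. {vs ! i,
      vs ! Suc i}) ` {..<length vs - 1}"
    by (intro image_cong) (auto simp: nth_append)
  also have "\<dots> = path_edges vs"
    by (auto simp: path_edges_def)
  finally show ?thesis using assms by (simp add: nth_append last_conv_nth)
qed

lemma path_edges_single [simp]: "path_edges [v] = {}"
  by (simp add: path_edges_def)

lemma path_edges_covers:
  assumes "2 \<le> length vs" "v \<in> set vs"
  shows "\<exists>e\<in>path_edges vs. v \<in> e"
proof -
  obtain i where i: "i < length vs" "v = vs ! i" using assms(2) by (auto simp: in_set_conv_nth)
  show ?thesis
  proof (cases "Suc i < length vs")
    case True
    then show ?thesis using i by (auto simp: path_edges_def)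
  next
    case False
    then have "i = Suc (i - 1)" using i assms(1) by auto
    then have "{vs ! (i - 1), v} \<in> path_edges vs"
      using i unfolding path_edges_def by (metis (mono_tags, lifting) mem_Collect_eq)
    then show ?thesis by auto
  qed
qed

text \<open>The map \<open>p\<close> sends a leaf to its neighbour on the path. Each path vertex
  receives its leaves while it is current, before the next spine step.\<close>

lemma built_path_with_leaves:
  assumes "vs \<noteq> []" "distinct vs" "finite X" "X \<inter> set vs = {}" "p ` X \<subseteq> set vs"
  shows "\<exists>w d. built w (set vs \<union> X) (path_edges vs \<union> (\<lambda>x. {p x, x}) ` X) d
      (last vs)"
  using assms
proof (induction vs arbitrary: X rule: rev_nonempty_induct)
  case (single v)
  have "p x = v" if "x \<in> X" for x using that single by auto
  then have "(\<lambda>x. {p x, x}) ` X = (\<lambda>x. {v, x}) ` X" by (intro image_cong) auto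
  moreover obtain w' where "built w' ({v} \<union> X) ({} \<union> (\<lambda>x. {v, x}) ` X) v v"
    using built_add_leaves[OF _ built_Nil[of v], of X] single by auto
  ultimately show ?case by auto
next
  case (snoc v vs)
  define Y Z where "Y = {x \<in> X. p x \<in> set vs}" and "Z = {x \<in> X. p x = v}"
  have X: "X = Y \<union> Z" "Y \<inter> (set vs \<union> {v}) = {}" "Z \<inter> (set vs \<union> {v}) = {}"
      "Y \<inter> Z = {}"
    using snoc.prems by (auto simp: Y_def Z_def)
  have Y: "finite Y" "Y \<inter> set vs = {}" "p ` Y \<subseteq> set vs"
    using snoc.prems(2) X(2) by (auto simp: Y_def)
  obtain w d where w: "built w (set vs \<union> Y) (path_edges vs \<union> (\<lambda>x. {p x, x}) ` Y) d
      (last vs)"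
    using snoc.IH[OF _ Y] snoc.prems(1) by auto
  have "v \<notin> set vs \<union> Y" using snoc.prems(1) X(2) by auto
  from built_Cons[OF w this, of True]
  have b: "built (True # w) (insert v (set vs \<union> Y)) (insert {last vs, v} (path_edges vs \<union>
      (\<lambda>x. {p x, x}) ` Y)) d v"
    by simp
  have "finite Z" using snoc.prems(2) by (simp add: Z_def)
  moreover have "Z \<inter> insert v (set vs \<union> Y) = {}" using X(3,4) by blast
  ultimately obtain w' where w': "built w' (insert v (set vs \<union> Y) \<union> Z)
      (insert {last vs, v} (path_edges vs \<union> (\<lambda>x. {p x, x}) ` Y) \<union> (\<lambda>x. {v, x})
          ` Z) d v"
    using built_add_leaves[OF _ b, of Z] by blast
  have "(\<lambda>x. {v, x}) ` Z = (\<lambda>x. {p x, x}) ` Z" by (intro image_cong) (auto simp: Z_def)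
  then have "insert {last vs, v} (path_edges vs \<union> (\<lambda>x. {p x, x}) ` Y) \<union> (\<lambda>x.
      {v, x}) ` Z =
      path_edges (vs @ [v]) \<union> (\<lambda>x. {p x, x}) ` X"
    using snoc.hyps by (simp add: path_edges_snoc X(1) image_Un Un_assoc)
  moreover have "insert v (set vs \<union> Y) \<union> Z = set (vs @ [v]) \<union> X" by (simp add: X(1)
      Un_assoc)
  ultimately show ?case using w' by (metis last_snoc)
qed

lemma component_of_connected:
  assumes "connected_graph V E" "u \<in> V"
  shows "component_of V E u = V"
proof
  show "V \<subseteq> component_of V E u"
    using assms by (simp add: component_of_def connected_graph_def subset_iff)
qed (rule component_of_subset)

lemma simple_graph_edgeE:
  assumes "simple_graph V E" "e \<in> E" "x \<in> e"
  obtains y where "e = {x, y}" "x \<in> V" "y \<in> V" "x \<noteq> y"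
proof -
  obtain u v where "e = {u, v}" "u \<in> V" "v \<in> V" "u \<noteq> v"
    using assms(1,2) unfolding simple_graph_def by blast
  moreover have "x = u \<or> x = v" using assms(3) calculation(1) by blast
  ultimately show ?thesis using that[of v] that[of u] by (metis insert_commute)
qed

lemma leaf_neighbour:
  assumes "simple_graph V E" "leaf V E x"
  obtains y where "\<And>u. {x, u} \<in> E \<longleftrightarrow> u = y"
proof -
  obtain e where e: "{e \<in> E. x \<in> e} = {e}"
    using assms(2) by (auto simp: leaf_def degree_def card_1_singleton_iff)
  then have "e \<in> E" "x \<in> e" by auto
  then obtain y where y: "e = {x, y}" by (rule simple_graph_edgeE[OF assms(1)])
  have "{x, u} \<in> E \<longleftrightarrow> u = y" for u
  proof
    assume "{x, u} \<in> E"
    then have "{x, u} \<in> {e \<in> E. x \<in> e}" by simp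
    then have "{x, u} = {x, y}" unfolding e y by simp
    then show "u = y" by (auto simp: doubleton_eq_iff)
  next
    assume "u = y"
    then show "{x, u} \<in> E" using \<open>e \<in> E\<close> y by simp
  qed
  then show ?thesis by (rule that)
qed

lemma caterpillar_built:
  assumes "caterpillar V E"
  shows "\<exists>w d c. built w V E d c"
proof -
  have G: "simple_graph V E" and conn: "connected_graph V E"
    using assms by (simp_all add: caterpillar_def tree_def)
  have "finite V" using G by (simp add: simple_graph_def)
  obtain vs where vs: "distinct vs" "set vs \<subseteq> V" "{e \<in> E. \<forall>v\<in>e. \<not> leaf V E v}
      = path_edges vs"
    using assms by (auto simp: caterpillar_def)
  have closed: "S = V" if "S \<subseteq> V" "u \<in> S" "\<And>a b. a \<in> S \<Longrightarrow> {a, b} \<in>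
      E \<Longrightarrow> b \<in> S" for S u
  proof -
    have "component_of V E u \<subseteq> S" by (rule component_of_closed[OF that(2)]) (rule that(3))
    moreover have "component_of V E u = V" using that(1,2) by (intro component_of_connected[OF conn]) auto
    ultimately show ?thesis using that(1) by simp
  qed
  have "\<exists>y. \<forall>u. {x, u} \<in> E \<longleftrightarrow> u = y" if "leaf V E x" for x
    using leaf_neighbour[OF G that] by metis
  then obtain p where p: "{x, u} \<in> E \<longleftrightarrow> u = p x" if "leaf V E x" for x u
    by metis
  have EV: "a \<in> V" "b \<in> V" "a \<noteq> b" if ab: "{a, b} \<in> E" for a b
  proof -
    obtain y where "{a, b} = {a, y}" "a \<in> V" "y \<in> V" "a \<noteq> y"
      using simple_graph_edgeE[OF G ab, of a] by blast
    then show "a \<in> V" "b \<in> V" "a \<noteq> b" by (auto simp: doubleton_eq_iff)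
  qed
  show ?thesis
  proof (cases "\<exists>v\<in>V. \<not> leaf V E v")
    case False
    \<comment> \<open>When all vertices are leaves, two neighbours have no further neighbours, and
      by connectedness the tree is a single edge.\<close>
    obtain v where v: "v \<in> V" using conn by (auto simp: connected_graph_def)
    then have lv: "leaf V E v" using False by auto
    define u where "u = p v"
    have uv: "{v, u} \<in> E" using p[OF lv] u_def by simp
    then have lu: "leaf V E u" "v = p u" using EV False p[of u v] by (auto simp: insert_commute)
    have V: "{v, u} = V"
    proof (rule closed[of _ v])
      fix a b assume "a \<in> {v, u}" and ab: "{a, b} \<in> E"
      then consider "a = v" | "a = u" by blast
      then show "b \<in> {v, u}"
      proof cases
        case 1
        then have "b = u" using p[OF lv, of b] ab unfolding u_def by simp
        then show ?thesis by simp
      next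
        case 2
        then have "b = v" unfolding lu(2) using p[OF lu(1), of b] ab by simp
        then show ?thesis by simp
      qed
    qed (use EV[OF uv] in auto)
    moreover have "E = {{v, u}}"
    proof -
      have "e = {v, u}" if e: "e \<in> E" for e
      proof -
        obtain x where "x \<in> e" using G e unfolding simple_graph_def by blast
        then obtain y where "e = {x, y}" "x \<in> V" "y \<in> V" "x \<noteq> y"
          by (rule simple_graph_edgeE[OF G e])
        then show ?thesis unfolding V[symmetric] by (auto simp: insert_commute)
      qed
      then show ?thesis using uv by blast
    qed
    ultimately show ?thesis
      using built_Cons[OF built_Nil[of v], of u False] EV(3)[OF uv] by (auto simp: insert_commute)
  next
    case True
    \<comment> \<open>If every edge meets a leaf, \<open>vs\<close> may be empty or consist of one
      leaf; a vertex that is not a leaf then serves as the spine.\<close>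
    define us where "us = (if path_edges vs = {} then [SOME v. v \<in> V \<and> \<not> leaf V E v] else vs)"
    have us: "us \<noteq> []" "distinct us" "path_edges us = {e \<in> E. \<forall>v\<in>e. \<not> leaf V E v}"
      using vs by (auto simp: us_def path_edges_def)
    have us_N: "v \<in> V \<and> \<not> leaf V E v" if "v \<in> set us" for v
    proof (cases "path_edges vs = {}")
      case True
      then have "v = (SOME v. v \<in> V \<and> \<not> leaf V E v)" using that by (simp add: us_def)
      then show ?thesis using someI_ex[of "\<lambda>v. v \<in> V \<and> \<not> leaf V E v"]
          \<open>\<exists>v\<in>V. \<not> leaf V E v\<close> by auto
    next
      case False
      then have "2 \<le> length vs" by (auto simp: path_edges_def)
      moreover have v: "v \<in> set vs" using that False by (simp add: us_def)
      ultimately obtain e where "e \<in> path_edges vs" "v \<in> e"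
        using path_edges_covers by metis
      then have "\<not> leaf V E v" unfolding vs(3)[symmetric] by blast
      then show ?thesis using vs(2) v by blast
    qed
    define X where "X = {x \<in> V. leaf V E x}"
    \<comment> \<open>The spine with the leaves hanging on it is closed under adjacency, so by
      connectedness no vertex is left over.\<close>
    have "set us \<union> {x \<in> X. p x \<in> set us} = V"
    proof (rule closed[of _ "hd us"])
      show "set us \<union> {x \<in> X. p x \<in> set us} \<subseteq> V" using us_N by (auto simp: X_def)
      show "hd us \<in> set us \<union> {x \<in> X. p x \<in> set us}" using us(1) by simp
      fix a b assume a: "a \<in> set us \<union> {x \<in> X. p x \<in> set us}" and ab: "{a, b} \<in> E"
      show "b \<in> set us \<union> {x \<in> X. p x \<in> set us}"
      proof (cases "a \<in> set us")
        case False
        then have "leaf V E a" "p a \<in> set us" using a by (auto simp: X_def)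
        then show ?thesis using p ab by auto
      next
        case True
        show ?thesis
        proof (cases "leaf V E b")
          case b: True
          then have "a = p b" using p[OF b, of a] ab by (simp add: insert_commute)
          then show ?thesis using True b EV[OF ab] by (simp add: X_def)
        next
          case b: False
          then have "{a, b} \<in> path_edges us" using ab us(3) us_N[OF True] by simp
          then have "b \<in> set us" unfolding path_edges_def by (auto simp: doubleton_eq_iff)
          then show ?thesis by simp
        qed
      qed
    qed
    then have V: "V = set us \<union> X" "X \<inter> set us = {}" "p ` X \<subseteq> set us"
      using us_N by (auto simp: X_def)
    have "E = path_edges us \<union> (\<lambda>x. {p x, x}) ` X"
    proof
      show "E \<subseteq> path_edges us \<union> (\<lambda>x. {p x, x}) ` X"
      proof
        fix e assume e: "e \<in> E"
        show "e \<in> path_edges us \<union> (\<lambda>x. {p x, x}) ` X"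
        proof (cases "\<exists>x\<in>e. leaf V E x")
          case True
          then obtain x where x: "x \<in> e" "leaf V E x" by blast
          then obtain y where "e = {x, y}" using simple_graph_edgeE[OF G e] by metis
          then have "e = {p x, x}" using e p[OF x(2), of y] by (simp add: insert_commute)
          then show ?thesis using x by (auto simp: X_def leaf_def)
        qed (use e us(3) in auto)
      qed
      show "path_edges us \<union> (\<lambda>x. {p x, x}) ` X \<subseteq> E"
        using us(3) p by (auto simp: X_def insert_commute)
    qed
    then show ?thesis
      using built_path_with_leaves[OF us(1,2) _ V(2,3)] \<open>finite V\<close> V(1) by (metis finite_Un)
  qed
qed

section \<open>The reconstruction procedure\<close>

lemma rec_id: "total_recursive (\<lambda>x. x)"
  using rec_pair[OF rec_fst rec_snd] by simp

lemma rec_const: "total_recursive (\<lambda>_. c)"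
proof (induction c)
  case (Suc c)
  then show ?case using rec_comp[OF rec_Suc] by simp
qed (rule rec_zero)

lemma rec_fst_of: "total_recursive f \<Longrightarrow> total_recursive (\<lambda>x. fst (prod_decode (f x)))"
  by (rule rec_comp[OF rec_fst])

lemma rec_snd_of: "total_recursive f \<Longrightarrow> total_recursive (\<lambda>x. snd (prod_decode (f x)))"
  by (rule rec_comp[OF rec_snd])

lemma rec_Suc_of: "total_recursive f \<Longrightarrow> total_recursive (\<lambda>x. Suc (f x))"
  by (rule rec_comp[OF rec_Suc])

text \<open>The whole argument \<open>x\<close> is passed on as the parameter of the primitive
  recursion, so the step may depend on it.\<close>

lemma rec_rec_nat:
  assumes "total_recursive f" "total_recursive b"
    "total_recursive (\<lambda>p. h (fst (prod_decode p)) (fst (prod_decode (snd (prod_decode p))))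
      (snd (prod_decode (snd (prod_decode p)))))"
  shows "total_recursive (\<lambda>x. rec_nat (f x) (h x) (b x))"
  using rec_comp[OF rec_prim[OF assms(1,3)] rec_pair[OF rec_id assms(2)]] by simp

lemmas rec_basic = rec_id rec_fst_of rec_snd_of rec_Suc_of rec_pair rec_const

lemma rec_add: "total_recursive f \<Longrightarrow> total_recursive g \<Longrightarrow> total_recursive
    (\<lambda>x. f x + g x)"
proof -
  assume "total_recursive f" "total_recursive g"
  then have "total_recursive (\<lambda>x. rec_nat (f x) (\<lambda>i r. Suc r) (g x))"
    by (intro rec_rec_nat rec_basic)
  moreover have "rec_nat a (\<lambda>i r. Suc r) b = a + b" for a b :: nat
    by (induction b) auto
  ultimately show ?thesis by simp
qed

lemma rec_mult: "total_recursive f \<Longrightarrow> total_recursive g \<Longrightarrow> total_recursive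
    (\<lambda>x. f x * g x)"
proof -
  assume fg: "total_recursive f" "total_recursive g"
  have "total_recursive (\<lambda>x. rec_nat 0 (\<lambda>i r. r + f x) (g x))"
    by (intro rec_rec_nat rec_basic rec_add fg rec_comp[OF fg(1)])
  moreover have "rec_nat 0 (\<lambda>i r. r + a) b = a * b" for a b :: nat
    by (induction b) auto
  ultimately show ?thesis by simp
qed

lemma rec_pow2: "total_recursive f \<Longrightarrow> total_recursive (\<lambda>x. 2 ^ f x)"
proof -
  assume f: "total_recursive f"
  have "total_recursive (\<lambda>x. rec_nat 1 (\<lambda>i r. r + r) (f x))"
    by (intro rec_rec_nat rec_basic rec_add f)
  moreover have "rec_nat 1 (\<lambda>i r. r + r) b = (2 ^ b :: nat)" for b
    by (induction b) auto
  ultimately show ?thesis by simp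
qed

lemma rec_diff: "total_recursive f \<Longrightarrow> total_recursive g \<Longrightarrow> total_recursive
    (\<lambda>x. f x - g x)"
proof -
  assume fg: "total_recursive f" "total_recursive g"
  \<comment> \<open>The inner recursion computes the predecessor.\<close>
  have "total_recursive (\<lambda>x. rec_nat (f x) (\<lambda>i r. rec_nat 0 (\<lambda>j q. j) r) (g x))"
    by (intro rec_rec_nat rec_basic fg)
  moreover have "rec_nat a (\<lambda>i r. rec_nat 0 (\<lambda>j q. j) r) b = a - b" for a b :: nat
  proof (induction b)
    case (Suc b)
    have "rec_nat 0 (\<lambda>j q. j) r = r - 1" for r :: nat by (cases r) auto
    then show ?case using Suc by simp
  qed simp
  ultimately show ?thesis by simp
qed

lemma rec_not: "total_recursive (\<lambda>x. of_bool (P x)) \<Longrightarrow> total_recursive (\<lambda>x.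
    of_bool (\<not> P x))"
proof -
  assume "total_recursive (\<lambda>x. of_bool (P x))"
  then have "total_recursive (\<lambda>x. 1 - of_bool (P x))"
    by (intro rec_diff rec_const)
  moreover have "(\<lambda>x. 1 - of_bool (P x) :: nat) = (\<lambda>x. of_bool (\<not> P x))"
    by auto
  ultimately show ?thesis by simp
qed

lemma rec_conj: "total_recursive (\<lambda>x. of_bool (P x)) \<Longrightarrow> total_recursive (\<lambda>x.
    of_bool (Q x)) \<Longrightarrow>
    total_recursive (\<lambda>x. of_bool (P x \<and> Q x))"
  unfolding of_bool_conj by (rule rec_mult)

lemma rec_disj:
  assumes "total_recursive (\<lambda>x. of_bool (P x))" "total_recursive (\<lambda>x. of_bool (Q x))"
  shows "total_recursive (\<lambda>x. of_bool (P x \<or> Q x))"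
  using rec_not[OF rec_conj[OF rec_not[OF assms(1)] rec_not[OF assms(2)]]] by simp

lemma rec_le:
  assumes "total_recursive f" "total_recursive g"
  shows "total_recursive (\<lambda>x. of_bool (f x \<le> g x))"
proof -
  have "(\<lambda>x. of_bool (f x \<le> g x)) = (\<lambda>x. 1 - (f x - g x))"
    by (auto simp: of_bool_def)
  then show ?thesis using rec_diff[OF rec_const[of 1] rec_diff[OF assms]] by simp
qed

lemma rec_eq:
  assumes "total_recursive f" "total_recursive g"
  shows "total_recursive (\<lambda>x. of_bool (f x = g x))"
  using rec_conj[OF rec_le[OF assms] rec_le[OF assms(2,1)]] by (simp add: eq_iff)

lemma rec_less:
  assumes "total_recursive f" "total_recursive g"
  shows "total_recursive (\<lambda>x. of_bool (f x < g x))"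
  using rec_not[OF rec_le[OF assms(2,1)]] by (simp add: not_le)

lemma rec_if:
  assumes "total_recursive (\<lambda>x. of_bool (P x))" "total_recursive f" "total_recursive g"
  shows "total_recursive (\<lambda>x. if P x then f x else g x)"
proof -
  have "(\<lambda>x. if P x then f x else g x) = (\<lambda>x. of_bool (P x) * f x + of_bool (\<not> P x) * g x)"
    by auto
  then show ?thesis using rec_add[OF rec_mult[OF assms(1,2)] rec_mult[OF rec_not[OF assms(1)] assms(3)]] by simp
qed

lemma rec_sum:
  assumes "total_recursive b" "total_recursive (\<lambda>p. f (fst (prod_decode p)) (snd (prod_decode p)))"
  shows "total_recursive (\<lambda>x. \<Sum>i<b x. f x i)"
proof -
  have "total_recursive (\<lambda>p. f (fst (prod_decode p)) (fst (prod_decode (snd (prod_decode p)))))"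
    using rec_comp[OF assms(2) rec_pair[OF rec_fst rec_fst_of[OF rec_snd]]] by simp
  then have "total_recursive (\<lambda>x. rec_nat 0 (\<lambda>i r. r + f x i) (b x))"
    by (intro rec_rec_nat rec_basic rec_add assms(1))
  moreover have "rec_nat 0 (\<lambda>i r. r + g i) n = (\<Sum>i<n. g i)" for g :: "nat \<Rightarrow> nat" and n
    by (induction n) auto
  ultimately show ?thesis by simp
qed

lemma rec_ex:
  assumes "total_recursive b" "total_recursive (\<lambda>p. of_bool (P (fst (prod_decode p)) (snd
      (prod_decode p))))"
  shows "total_recursive (\<lambda>x. of_bool (\<exists>i<b x. P x i))"
proof -
  have "(\<lambda>x. of_bool (\<exists>i<b x. P x i)) = (\<lambda>x. of_bool (1 \<le> (\<Sum>i<b x. of_bool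
      (P x i) :: nat)) :: nat)"
    by (auto simp: fun_eq_iff Suc_le_eq card_gt_0_iff)
  then show ?thesis
    using rec_le[OF rec_const[of 1] rec_sum[OF assms(1), of "\<lambda>x i. of_bool (P x i)"]] assms(2) by simp
qed

lemma rec_odd:
  assumes "total_recursive f"
  shows "total_recursive (\<lambda>x. of_bool (odd (f x)))"
proof -
  have "total_recursive (\<lambda>x. rec_nat 0 (\<lambda>i r. 1 - r) (f x))"
    by (intro rec_rec_nat rec_basic rec_diff assms)
  moreover have "rec_nat 0 (\<lambda>i r. 1 - r) n = (of_bool (odd n) :: nat)" for n
    by (induction n) auto
  ultimately show ?thesis by simp
qed

lemma rec_div_pow2:
  assumes "total_recursive f" "total_recursive g"
  shows "total_recursive (\<lambda>x. f x div 2 ^ g x)"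
proof -
  \<comment> \<open>Half of \<open>n\<close>, rounded down, is the number of odd numbers below
    \<open>n\<close>; repeated halving gives division by the power.\<close>
  have half: "rec_nat 0 (\<lambda>i r. r + of_bool (odd i)) n = n div 2" for n :: nat
    by (induction n) auto
  have "total_recursive (\<lambda>x. rec_nat (f x) (\<lambda>i r. rec_nat 0 (\<lambda>i r. r + of_bool (odd
      i)) r) (g x))"
    by (intro rec_rec_nat rec_basic rec_add rec_odd assms)
  moreover have "rec_nat a (\<lambda>i r. r div 2) b = a div 2 ^ b" for a b :: nat
    by (induction b) (simp_all add: div_mult2_eq mult.commute[of 2])
  ultimately show ?thesis by (simp add: half)
qed

lemma rec_set_decode:
  assumes "total_recursive f" "total_recursive g"
  shows "total_recursive (\<lambda>x. of_bool (g x \<in> set_decode (f x)))"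
  unfolding set_decode_def mem_Collect_eq by (intro rec_odd rec_div_pow2 assms)

lemmas rec_rules = rec_basic rec_add rec_mult rec_pow2 rec_diff rec_not rec_conj rec_disj rec_le rec_eq rec_less
  rec_if rec_sum rec_ex rec_set_decode rec_rec_nat

section \<open>Words and their trees coded by numbers\<close>

primrec word :: "(nat \<Rightarrow> bool) \<Rightarrow> nat \<Rightarrow> bool list" where
  "word s 0 = []"
| "word s (Suc n) = s n # word s n"

lemma length_word [simp]: "length (word s n) = n"
  by (induction n) auto

text \<open>The current vertex after n steps, where step i adds the vertex \<open>i + 1\<close>.\<close>

definition parent :: "(nat \<Rightarrow> bool) \<Rightarrow> nat \<Rightarrow> nat" where
  "parent s n = rec_nat 0 (\<lambda>i r. if s i then Suc i else r) n"

definition word_edges :: "(nat \<Rightarrow> bool) \<Rightarrow> nat \<Rightarrow> nat set set" where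
  "word_edges s n = (\<lambda>i. {parent s i, Suc i}) ` {..<n}"

lemma parent_Suc: "parent s (Suc n) = (if s n then Suc n else parent s n)"
  by (simp add: parent_def)

lemma word_edges_Suc: "word_edges s (Suc n) = insert {parent s n, Suc n} (word_edges s n)"
  by (simp add: word_edges_def lessThan_Suc)

lemma parent_le: "parent s n \<le> n"
  by (induction n) (auto simp: parent_def)

lemma built_word: "built (word s n) {..<Suc n} (word_edges s n) 0 (parent s n)"
proof (induction n)
  case 0
  then show ?case using built_Nil[of 0] by (simp add: word_edges_def parent_def lessThan_Suc)
next
  case (Suc n)
  have "built (s n # word s n) (insert (Suc n) {..<Suc n}) (insert {parent s n, Suc n} (word_edges s n)) 0
      (if s n then Suc n else parent s n)"
    by (intro built_Cons Suc) simp
  then show ?case unfolding word.simps word_edges_Suc parent_Suc lessThan_Suc[of "Suc n"] .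
qed

text \<open>The second components \<open>Suc i\<close> make the exponents distinct, so the sum is
  the binary code of the set of edges.\<close>

definition graph_code :: "(nat \<Rightarrow> bool) \<Rightarrow> nat \<Rightarrow> nat" where
  "graph_code s n = prod_encode (Suc n, \<Sum>i<n. 2 ^ prod_encode (parent s i, Suc i))"

lemma decode_verts_graph_code: "decode_verts (graph_code s n) = {..<Suc n}"
  by (simp add: decode_verts_def graph_code_def)

lemma decode_edges_graph_code: "decode_edges (graph_code s n) = word_edges s n"
proof -
  have "inj_on (\<lambda>i. prod_encode (parent s i, Suc i)) {..<n}" by (auto simp: inj_on_def)
  then have "(\<Sum>i<n. 2 ^ prod_encode (parent s i, Suc i)) =
      set_encode ((\<lambda>i. prod_encode (parent s i, Suc i)) ` {..<n})"
    by (simp add: set_encode_def sum.reindex)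
  then have "set_decode (snd (prod_decode (graph_code s n))) = (\<lambda>i. prod_encode (parent s i, Suc i))
      ` {..<n}"
    by (simp add: graph_code_def)
  then have mem: "prod_encode (i, j) \<in> set_decode (snd (prod_decode (graph_code s n))) \<longleftrightarrow>
      (\<exists>k<n. i = parent s k \<and> j = Suc k)" for i j
    by auto
  show ?thesis
  proof
    show "decode_edges (graph_code s n) \<subseteq> word_edges s n"
      unfolding decode_edges_def mem word_edges_def by blast
    show "word_edges s n \<subseteq> decode_edges (graph_code s n)"
    proof
      fix e assume "e \<in> word_edges s n"
      then obtain k where k: "k < n" "e = {parent s k, Suc k}" by (auto simp: word_edges_def)
      moreover have "parent s k < Suc n" "parent s k \<noteq> Suc k" using parent_le[of s k] k(1) by auto
      ultimately show "e \<in> decode_edges (graph_code s n)"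
        unfolding decode_edges_def decode_verts_graph_code mem by blast
    qed
  qed
qed

lemma rec_parent:
  assumes "total_recursive f" "total_recursive g"
  shows "total_recursive (\<lambda>x. parent (\<lambda>j. j \<in> set_decode (f x)) (g x))"
  unfolding parent_def by (intro rec_rules assms rec_comp[OF assms(1)])

text \<open>An edge set is given by the set m of the steps whose edges it contains.\<close>

primrec run :: "(nat \<Rightarrow> bool) \<Rightarrow> (nat \<Rightarrow> bool) \<Rightarrow> nat
    \<Rightarrow> state" where
  "run m s 0 = ({#}, 0)"
| "run m s (Suc n) = (if m n then attach else detach (s n)) (run m s n)"

lemma run_cong: "(\<And>j. j < n \<Longrightarrow> m j = m' j) \<Longrightarrow> run m s n = run m' s n"
  by (induction n) auto

lemma set_decode_less:
  assumes "a < 2 ^ n" "j \<in> set_decode a"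
  shows "j < n"
proof (rule ccontr)
  assume "\<not> j < n"
  then have "(2::nat) ^ n \<le> 2 ^ j" by (intro power_increasing) auto
  then have "a div 2 ^ j = 0" using assms(1) by (intro div_less) linarith
  then show False using assms(2) by (simp add: set_decode_def)
qed

text \<open>Edge sets are numbered by their binary codes, in which bit \<open>n\<close> decides
  about the newest edge.\<close>

lemma states_word: "states (word s n) = image_mset (\<lambda>a. run (\<lambda>j. j \<in> set_decode a) s n)
    (mset_set {..<2 ^ n})"
proof (induction n)
  case 0
  then show ?case by (simp add: lessThan_Suc)
next
  case (Suc n)
  let ?r = "\<lambda>n a. run (\<lambda>j. j \<in> set_decode a) s n"
  have dec: "set_decode (2 ^ n + a) = insert n (set_decode a)" if "a < 2 ^ n" for a
    using set_decode_plus_power_2 set_decode_less[OF that] by blast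
  have low: "?r (Suc n) a = detach (s n) (?r n a)" if "a < 2 ^ n" for a
    using set_decode_less[OF that, of n] by auto
  have high: "?r (Suc n) (2 ^ n + a) = attach (?r n a)" if "a < 2 ^ n" for a
    using dec[OF that] run_cong[of n "\<lambda>j. j \<in> set_decode (2 ^ n + a)" "\<lambda>j. j \<in>
        set_decode a" s] by simp
  have "{..<2 ^ Suc n} = {..<2 ^ n} \<union> (\<lambda>a. 2 ^ n + a) ` {..<2 ^ n :: nat}"
  proof (intro set_eqI iffI)
    fix x :: nat assume x: "x \<in> {..<2 ^ Suc n}"
    show "x \<in> {..<2 ^ n} \<union> (\<lambda>a. 2 ^ n + a) ` {..<2 ^ n}"
    proof (cases "x < 2 ^ n")
      case False
      then have "x = 2 ^ n + (x - 2 ^ n)" "x - 2 ^ n < 2 ^ n" using x by auto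
      then show ?thesis by blast
    qed simp
  qed auto
  then have "mset_set {..<2 ^ Suc n} = mset_set {..<2 ^ n} + mset_set ((\<lambda>a. 2 ^ n + a) ` {..<2 ^ n ::
      nat})"
    by (simp only:) (intro mset_set_Union; auto)
  also have "mset_set ((\<lambda>a. 2 ^ n + a) ` {..<2 ^ n}) = image_mset (\<lambda>a. 2 ^ n + a) (mset_set
      {..<2 ^ n :: nat})"
    by (simp add: image_mset_mset_set)
  finally have "image_mset (?r (Suc n)) (mset_set {..<2 ^ Suc n}) =
      image_mset (?r (Suc n)) (mset_set {..<2 ^ n}) + image_mset (\<lambda>a. ?r (Suc n) (2 ^ n + a))
          (mset_set {..<2 ^ n})"
    by (simp only: image_mset_union image_mset.compositionality comp_def)
  also have "\<dots> = image_mset (\<lambda>a. detach (s n) (?r n a)) (mset_set {..<2 ^ n}) +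
      image_mset (\<lambda>a. attach (?r n a)) (mset_set {..<2 ^ n})"
    using low high by (intro arg_cong2[of _ _ _ _ "(+)"] image_mset_cong) (simp_all only: finite_lessThan
        elem_mset_set lessThan_iff)
  finally show ?case
    by (simp only: word.simps states.simps Suc image_mset.compositionality comp_def add.commute)
qed

section \<open>Computing the code of the polynomial\<close>

definition cur_size :: "(nat \<Rightarrow> bool) \<Rightarrow> (nat \<Rightarrow> bool) \<Rightarrow> nat
    \<Rightarrow> nat" where
  "cur_size m s n = rec_nat 0 (\<lambda>j r. if m j then Suc r else if s j then 0 else r) n"

text \<open>Multiplicities replace the multiset of \<open>run\<close>, because the recursive
  functions handle only numbers. An absent edge closes the current component at a spine step and a
  single leaf otherwise.\<close>

definition closed_count :: "(nat \<Rightarrow> bool) \<Rightarrow> (nat \<Rightarrow> bool) \<Rightarrow> nat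
    \<Rightarrow> nat \<Rightarrow> nat" where
  "closed_count m s i n =
    rec_nat 0 (\<lambda>j r. if m j then r else r + of_bool ((if s j then cur_size m s j else 0) = i)) n"

definition part_count :: "(nat \<Rightarrow> bool) \<Rightarrow> (nat \<Rightarrow> bool) \<Rightarrow> nat
    \<Rightarrow> nat \<Rightarrow> nat" where
  "part_count m s n i = closed_count m s i n + of_bool (cur_size m s n = i)"

definition run_type :: "(nat \<Rightarrow> bool) \<Rightarrow> (nat \<Rightarrow> bool) \<Rightarrow> nat
    \<Rightarrow> nat multiset" where
  "run_type m s n = (case run m s n of (M, c) \<Rightarrow> add_mset c M)"

lemma snd_run: "snd (run m s n) = cur_size m s n"
proof (induction n)
  case (Suc n)
  then show ?case by (cases "run m s n") (auto simp: cur_size_def)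
qed (simp add: cur_size_def)

lemma count_fst_run: "count (fst (run m s n)) i = closed_count m s i n"
proof (induction n)
  case (Suc n)
  then show ?case using snd_run[of m s n] by (cases "run m s n") (auto simp: closed_count_def)
qed (simp add: closed_count_def)

lemma count_run_type: "count (run_type m s n) i = part_count m s n i"
  using snd_run[of m s n] count_fst_run[of m s n i]
  by (cases "run m s n") (auto simp: run_type_def part_count_def)

lemma part_types_word:
  "part_types (word s n) = image_mset (\<lambda>a. run_type (\<lambda>j. j \<in> set_decode a) s n) (mset_set
      {..<2 ^ n})"
  by (simp add: part_types_def states_word image_mset.compositionality comp_def run_type_def)

definition monom_code :: "(nat \<Rightarrow> bool) \<Rightarrow> (nat \<Rightarrow> bool) \<Rightarrow> nat
    \<Rightarrow> nat" where
  "monom_code m s n =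
    (\<Sum>i<Suc n. if part_count m s n i = 0 then 0 else 2 ^ prod_encode (Suc i, part_count m s n i))"

lemma encode_type_monom:
  assumes "\<And>i. i \<in># M \<Longrightarrow> i < n"
  shows "encode_monom (type_monom M) = (\<Sum>i<n. if count M i = 0 then 0 else 2 ^ prod_encode (Suc i, count
      M i))"
proof -
  have "Poly_Mapping.keys (type_monom M) = Suc ` set_mset M"
    by (auto simp: in_keys_iff lookup_type_monom image_iff split: nat.splits)
  then have "encode_monom (type_monom M) = set_encode ((\<lambda>i. prod_encode (Suc i, count M i)) `
      set_mset M)"
    by (simp add: encode_monom_def image_image lookup_type_monom)
  also have "\<dots> = (\<Sum>i\<in>set_mset M. 2 ^ prod_encode (Suc i, count M i))"
    unfolding set_encode_def by (subst sum.reindex) (auto simp: inj_on_def)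
  also have "\<dots> = (\<Sum>i<n. if count M i = 0 then 0 else 2 ^ prod_encode (Suc i, count M i))"
    using assms by (intro sum.mono_neutral_cong_left) (auto simp: count_eq_zero_iff)
  finally show ?thesis .
qed

lemma encode_run_type:
  "a < 2 ^ n \<Longrightarrow> encode_monom (type_monom (run_type (\<lambda>j. j \<in> set_decode a) s n)) =
      monom_code (\<lambda>j. j \<in> set_decode a) s n"
proof -
  assume "a < 2 ^ n"
  then have M: "run_type (\<lambda>j. j \<in> set_decode a) s n \<in># part_types (word s n)" (is "?M \<in># _")
    by (simp add: part_types_word)
  have "i < Suc n" if i: "i \<in># ?M" for i
  proof -
    obtain N where "?M = add_mset i N" using i by (metis insert_DiffM)
    then show ?thesis using part_types_size[OF M] by simp
  qed
  then show ?thesis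
    by (simp only: encode_type_monom[of ?M "Suc n"] monom_code_def count_run_type)
qed

lemma sum_first_occurrences:
  fixes h :: "'a \<Rightarrow> nat" and n :: nat
  shows "(\<Sum>a<n. if \<exists>a'<a. f a' = f a then 0 else h (f a)) = (\<Sum>y\<in>f ` {..<n}. h y)"
proof (induction n)
  case (Suc n)
  have "(\<exists>a'<n. f a' = f n) \<longleftrightarrow> f n \<in> f ` {..<n}" by (metis image_iff
      lessThan_iff)
  then show ?case
    using Suc by (cases "f n \<in> f ` {..<n}") (auto simp: lessThan_Suc insert_absorb)
qed simp

text \<open>Many edge sets may share a monomial, which must enter the code once; only the least of
  them contributes. The factor 2 is \<open>int_encode\<close> on nonnegative integers.\<close>

definition poly_code :: "(nat \<Rightarrow> bool) \<Rightarrow> nat \<Rightarrow> nat" where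
  "poly_code s n = (\<Sum>a<2 ^ n. if \<exists>a'<a. monom_code (\<lambda>j. j \<in> set_decode a') s n =
      monom_code (\<lambda>j. j \<in> set_decode a) s n then 0
     else 2 ^ prod_encode (monom_code (\<lambda>j. j \<in> set_decode a) s n,
       2 * (\<Sum>a'<2 ^ n. of_bool (monom_code (\<lambda>j. j \<in> set_decode a') s n = monom_code
           (\<lambda>j. j \<in> set_decode a) s n))))"

lemma int_encode_of_nat: "int_encode (int k) = 2 * k"
  by (simp add: int_encode_def sum_encode_def)

lemma poly_code_eq:
  "encode_poly (\<Sum>M\<in>#part_types (word s n). Poly_Mapping.single (type_monom M) 1) = poly_code s n"
proof -
  define t where "t a = type_monom (run_type (\<lambda>j. j \<in> set_decode a) s n)" for a
  define c where "c a = monom_code (\<lambda>j. j \<in> set_decode a) s n" for a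
  define p :: poly where "p = (\<Sum>M\<in>#part_types (word s n). Poly_Mapping.single (type_monom M) 1)"
  have ct: "encode_monom (t a) = c a" if "a < 2 ^ n" for a
    using encode_run_type[OF that] by (simp add: t_def c_def)
  have T: "image_mset type_monom (part_types (word s n)) = image_mset t (mset_set {..<2 ^ n})"
    by (simp add: part_types_word image_mset.compositionality comp_def t_def[abs_def])
  have lookup: "Poly_Mapping.lookup p m = int (count (image_mset t (mset_set {..<2 ^ n})) m)" for m
    unfolding p_def lookup_sum_mset_single T ..
  have keys: "Poly_Mapping.keys p = t ` {..<2 ^ n}"
    by (auto simp: in_keys_iff lookup count_eq_zero_iff)
  define N where "N y = (\<Sum>a<2 ^ n. of_bool (c a = y) :: nat)" for y
  have count: "count (image_mset t (mset_set {..<2 ^ n})) m = N (encode_monom m)" for m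
  proof -
    have "count (image_mset t (mset_set {..<2 ^ n})) m = card {a \<in> {..<2 ^ n}. t a = m}"
      by (simp add: count_image_mset Int_def vimage_def conj_commute)
    also have "{a \<in> {..<2 ^ n}. t a = m} = {a \<in> {..<2 ^ n}. c a = encode_monom m}"
      using inj_eq[OF inj_encode_monom, symmetric] ct by (intro Collect_cong) auto
    also have "card \<dots> = N (encode_monom m)"
      by (simp add: N_def Int_def)
    finally show ?thesis .
  qed
  have "encode_poly p = set_encode ((\<lambda>y. prod_encode (y, 2 * N y)) ` encode_monom ` t ` {..<2 ^ n})"
    unfolding encode_poly_def keys lookup int_encode_of_nat count image_image ..
  also have "encode_monom ` t ` {..<2 ^ n} = c ` {..<2 ^ n}"
    unfolding image_image using ct by (intro image_cong) auto
  also have "set_encode ((\<lambda>y. prod_encode (y, 2 * N y)) ` c ` {..<2 ^ n}) = (\<Sum>y\<in>c ` {..<2 ^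
      n}. 2 ^ prod_encode (y, 2 * N y))"
    unfolding set_encode_def by (subst sum.reindex) (auto simp: inj_on_def)
  also have "\<dots> = (\<Sum>a<2 ^ n. if \<exists>a'<a. c a' = c a then 0 else 2 ^ prod_encode (c a, 2 * N
      (c a)))"
    by (rule sum_first_occurrences[symmetric])
  finally show ?thesis
    unfolding p_def poly_code_def N_def c_def .
qed

lemma rec_monom_code:
  assumes "total_recursive f" "total_recursive g" "total_recursive h"
  shows "total_recursive (\<lambda>x. monom_code (\<lambda>j. j \<in> set_decode (f x)) (\<lambda>j. j \<in>
      set_decode (g x)) (h x))"
  unfolding monom_code_def part_count_def closed_count_def cur_size_def
  by (intro rec_rules assms rec_comp[OF assms(1)] rec_comp[OF assms(2)] rec_comp[OF assms(3)])

lemma rec_poly_code: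
  assumes "total_recursive g" "total_recursive h"
  shows "total_recursive (\<lambda>x. poly_code (\<lambda>j. j \<in> set_decode (g x)) (h x))"
  unfolding poly_code_def
  by (intro rec_rules rec_monom_code assms rec_comp[OF assms(1)] rec_comp[OF assms(2)])

lemma rec_graph_code:
  assumes "total_recursive g" "total_recursive h"
  shows "total_recursive (\<lambda>x. graph_code (\<lambda>j. j \<in> set_decode (g x)) (h x))"
  unfolding graph_code_def
  by (intro rec_rules rec_parent assms rec_comp[OF assms(1)] rec_comp[OF assms(2)])

section \<open>The bounded search\<close>

definition code_len :: "nat \<Rightarrow> nat" where
  "code_len k = fst (prod_decode k)"

definition code_letter :: "nat \<Rightarrow> nat \<Rightarrow> bool" where
  "code_letter k = (\<lambda>j. j \<in> set_decode (snd (prod_decode k)))"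

definition search_done :: "nat \<Rightarrow> nat \<Rightarrow> bool" where
  "search_done p k \<longleftrightarrow> (code_len k = 0 \<or> \<not> code_letter k 0 \<and> \<not>
      code_letter k (code_len k - 1)) \<and>
     poly_code (code_letter k) (code_len k) = p"

text \<open>The search must end for every p, also for those that are not codes of U-polynomials.\<close>

definition search_bound :: "nat \<Rightarrow> nat" where
  "search_bound p = prod_encode (p, 2 ^ p)"

definition reconstruct :: "nat \<Rightarrow> nat" where
  "reconstruct p = (let k = LEAST k. search_done p k \<or> search_bound p < k
     in graph_code (code_letter k) (code_len k))"

lemma rec_search:
  "total_recursive (\<lambda>x. of_bool (\<not> (search_done (fst (prod_decode x)) (snd (prod_decode x)) \<or>
     search_bound (fst (prod_decode x)) < snd (prod_decode x))))"
  unfolding search_done_def search_bound_def code_len_def code_letter_def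
  by (intro rec_rules rec_poly_code)

lemma total_recursive_reconstruct: "total_recursive reconstruct"
proof -
  define f where "f x = (of_bool (\<not> (search_done (fst (prod_decode x)) (snd (prod_decode x)) \<or>
     search_bound (fst (prod_decode x)) < snd (prod_decode x))) :: nat)" for x
  have f: "f (prod_encode (p, k)) = 0 \<longleftrightarrow> search_done p k \<or> search_bound p < k" for p k
    by (simp add: f_def)
  have "total_recursive f" unfolding f_def by (rule rec_search)
  moreover have "\<forall>p. \<exists>k. f (prod_encode (p, k)) = 0"
    unfolding f by (meson lessI)
  ultimately have "total_recursive (\<lambda>p. LEAST k. f (prod_encode (p, k)) = 0)"
    by (rule rec_mu)
  then have least: "total_recursive (\<lambda>p. LEAST k. search_done p k \<or> search_bound p < k)"
    unfolding f .
  show ?thesis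
    unfolding reconstruct_def Let_def code_letter_def code_len_def
    by (intro rec_graph_code rec_fst_of rec_snd_of least)
qed

lemma prod_encode_mono: "a \<le> a' \<Longrightarrow> b \<le> b' \<Longrightarrow> prod_encode (a, b) \<le>
    prod_encode (a', b')"
  unfolding prod_encode_def triangle_def
  by (auto intro!: add_mono div_le_mono mult_le_mono)

lemma less_set_encode: "finite A \<Longrightarrow> x \<in> A \<Longrightarrow> x < set_encode A"
  unfolding set_encode_def
  by (rule order_less_le_trans[OF less_exp]) (auto intro: member_le_sum)

lemma less_encode_poly: "m \<in> Poly_Mapping.keys p \<Longrightarrow> encode_monom m < encode_poly p"
  using less_set_encode[of "(\<lambda>m. prod_encode (encode_monom m, int_encode (Poly_Mapping.lookup p m)))
      ` Poly_Mapping.keys p"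
      "prod_encode (encode_monom m, int_encode (Poly_Mapping.lookup p m))"]
    le_prod_encode_1[of "encode_monom m" "int_encode (Poly_Mapping.lookup p m)"]
  by (auto simp: encode_poly_def)

lemma less_encode_monom: "i \<in> Poly_Mapping.keys m \<Longrightarrow> Poly_Mapping.lookup m i <
    encode_monom m"
  using less_set_encode[of "(\<lambda>i. prod_encode (i, Poly_Mapping.lookup m i)) ` Poly_Mapping.keys m"
      "prod_encode (i, Poly_Mapping.lookup m i)"]
    le_prod_encode_2[of "Poly_Mapping.lookup m i" i]
  by (auto simp: encode_monom_def)

lemma run_isolated: "run (\<lambda>_. False) s n = (replicate_mset n 0, 0)"
  by (induction n) auto

text \<open>The empty edge set gives a term in which \<open>var 1\<close> has exponent
  \<open>Suc n\<close>, and a binary set code exceeds its members, so codes of monomials exceed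
  their exponents and codes of polynomials those of their monomials.\<close>

lemma length_less_poly_code: "n < poly_code s n"
proof -
  define p :: poly where "p = (\<Sum>M\<in>#part_types (word s n). Poly_Mapping.single (type_monom M) 1)"
  define M where "M = replicate_mset (Suc n) (0 :: nat)"
  have "run_type (\<lambda>j. j \<in> set_decode 0) s n = M"
    by (simp add: run_type_def run_isolated M_def)
  then have M: "M \<in># part_types (word s n)"
    unfolding part_types_word by (auto simp: image_iff intro!: bexI[of _ 0])
  then have "Poly_Mapping.lookup p (type_monom M) \<noteq> 0"
    unfolding p_def lookup_sum_mset_single by auto
  then have "encode_monom (type_monom M) < poly_code s n"
    using less_encode_poly[of "type_monom M" p] by (simp add: in_keys_iff p_def poly_code_eq)
  moreover have "Poly_Mapping.lookup (type_monom M) (Suc 0) = Suc n"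
    by (simp add: lookup_type_monom M_def)
  then have "Suc n < encode_monom (type_monom M)"
    using less_encode_monom[of "Suc 0" "type_monom M"] by (simp add: in_keys_iff)
  ultimately show ?thesis by simp
qed

lemma word_nth_rev: "word (\<lambda>j. rev w ! j) (length w) = w"
proof -
  have "word s n = rev (map s [0..<n])" for s n
    by (induction n) auto
  then show ?thesis by (simp add: map_nth[of "rev w", simplified])
qed

lemma word_cong: "(\<And>j. j < n \<Longrightarrow> s j = t j) \<Longrightarrow> word s n = word t n"
  by (induction n) auto

lemma hd_last_word: "0 < n \<Longrightarrow> hd (word s n) = s (n - 1) \<and> last (word s n) = s 0"
proof (induction n)
  case (Suc n)
  then show ?case by (cases n) auto
qed simp

lemma normal_word_word: "normal_word (word s n) \<longleftrightarrow> n = 0 \<or> \<not> s 0 \<and> \<not> s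
    (n - 1)"
proof (cases "n = 0")
  case False
  then have "word s n \<noteq> []" by (cases n) auto
  then show ?thesis using False hd_last_word[of n s] by (auto simp: normal_word_def)
qed (simp add: normal_word_def)

lemma reconstruct_correct:
  fixes V :: "'a set"
  assumes "caterpillar V E"
  defines "c \<equiv> reconstruct (encode_poly (U_polynomial V E))"
  shows "graph_iso (decode_verts c) (decode_edges c) V E"
proof -
  obtain w d u where w: "built w V E d u" "normal_word w"
    using caterpillar_built[OF assms(1)] built_normal by metis
  define p where "p = encode_poly (U_polynomial V E)"
  define n where "n = length w"
  \<comment> \<open>The word is reversed because \<open>word\<close> lists the latest step
    first.\<close>
  define b where "b = set_encode {j. j < n \<and> rev w ! j}"
  define k0 where "k0 = prod_encode (n, b)"
  have "code_letter k0 j \<longleftrightarrow> j < n \<and> rev w ! j" for j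
    by (simp add: code_letter_def k0_def b_def)
  then have "word (code_letter k0) n = word (\<lambda>j. rev w ! j) n"
    by (intro word_cong) simp
  then have w0: "word (code_letter k0) n = w" by (simp add: n_def word_nth_rev)
  have len0: "code_len k0 = n" by (simp add: code_len_def k0_def)
  have p: "p = poly_code (code_letter k0) n"
    unfolding p_def U_polynomial_built[OF w(1)] poly_code_eq[symmetric] w0 ..
  have done0: "search_done p k0"
    using w(2) normal_word_word[of "code_letter k0" n] unfolding search_done_def len0 w0 p[symmetric] by simp
  have "n < p" using length_less_poly_code p by simp
  have "b \<le> (\<Sum>j<n. 2 ^ j)"
    unfolding b_def set_encode_def by (intro sum_mono2) auto
  also have "\<dots> < 2 ^ n"
    by (induction n) auto
  also have "\<dots> \<le> 2 ^ p" using \<open>n < p\<close> by (intro power_increasing) auto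
  finally have "k0 \<le> search_bound p"
    using \<open>n < p\<close> unfolding k0_def search_bound_def by (intro prod_encode_mono) auto
  define k where "k = (LEAST k. search_done p k \<or> search_bound p < k)"
  have "k \<le> k0" unfolding k_def using done0 by (intro Least_le) simp
  moreover have "search_done p k \<or> search_bound p < k"
    unfolding k_def by (rule LeastI[of _ k0]) (simp add: done0)
  \<comment> \<open>The code \<open>k0\<close> of \<open>w\<close> lies within the bound, so the
    search ends by success and not by exhaustion.\<close>
  ultimately have "search_done p k" using \<open>k0 \<le> search_bound p\<close> by linarith
  define v where "v = word (code_letter k) (code_len k)"
  have "normal_word v" "poly_code (code_letter k) (code_len k) = p"
    using \<open>search_done p k\<close> by (simp_all add: search_done_def v_def normal_word_word)
  then have "encode_poly (\<Sum>M\<in>#part_types v. Poly_Mapping.single (type_monom M) 1) =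
      encode_poly (\<Sum>M\<in>#part_types w. Poly_Mapping.single (type_monom M) 1)"
    unfolding v_def poly_code_eq p_def U_polynomial_built[OF w(1)] by simp
  then have "part_types v = part_types w"
    by (intro part_types_eqI injD[OF inj_encode_poly])
  then have w_v: "w = v \<or> w = rev v"
    using part_types_determine_word[of w v] w(2) \<open>normal_word v\<close> by simp
  have c: "c = graph_code (code_letter k) (code_len k)"
    unfolding c_def reconstruct_def Let_def p_def[symmetric] k_def[symmetric] ..
  have built_c: "built v (decode_verts c) (decode_edges c) 0 (parent (code_letter k) (code_len k))"
    unfolding c decode_verts_graph_code decode_edges_graph_code v_def by (rule built_word)
  from w_v show ?thesis
  proof
    assume "w = v"
    then show ?thesis using built_graph_iso[OF built_c] w(1) by simp
  next
    assume "w = rev v"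
    then show ?thesis using built_graph_iso[OF built_rev[OF built_c]] w(1) by simp
  qed
qed

theorem theorem2:
  shows "\<exists>R. total_recursive R \<and>
    (\<forall>(V :: 'a set) E. caterpillar V E \<longrightarrow>
      (let c = R (encode_poly (U_polynomial V E))
       in graph_iso (decode_verts c) (decode_edges c) V E))"
  using total_recursive_reconstruct reconstruct_correct unfolding Let_def by blast

end
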